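(* Let $\mathbf{G}$ be a locally compact topological groupoid (second countable, Hausdorff) with a continuous Haar system $\lambda=\{\lambda^x\}$, and let $P$ be an invariant Markov operator on $\mathbf{G}$ with continuous densities (its transition probabilities are absolutely continuous with respect to the Haar system with continuous densities). If $P$ is topologically fiberwise Liouville, i.e., the operator $P_x:L^\infty(\mathbf{G}^x,\lambda^x)\to L^\infty(\mathbf{G}^x,\lambda^x)$ is Liouville for every $x\in\mathbf{G}^{(0)}$, then the groupoid $\mathbf{G}$ is topologically amenable.
   Context: Groupoids. A groupoid $\mathbf{G}$ is a small category in which every morphism is invertible; $\mathbf{G}$ also denotes its set of morphisms, $\mathbf{G}^{(0)}$ its set of objects, identified with a subset of $\mathbf{G}$ via $x\mapsto\boldsymbol{\varepsilon}_x$ (identity morphism at $x$), and $\mathsf{s},\mathsf{t}:\mathbf{G}\to\mathbf{G}^{(0)}$ the source and target maps. $\mathbf{G}^{(2)}=\{(g_1,g_2):\mathsf{s}(g_1)=\mathsf{t}(g_2)\}$ is the set of composable pairs, with $\mathsf{s}(g_1g_2)=\mathsf{s}(g_2)$, $\mathsf{t}(g_1g_2)=\mathsf{t}(g_1)$. Put $\mathbf{G}^x=\mathsf{t}^{-1}(x)$. For $g\in\mathbf{G}$ and a measure $\theta$ on $\mathbf{G}^{\mathsf{s}(g)}$, $g\theta$ is the image of $\theta$ under $h\mapsto gh$, a measure on $\mathbf{G}^{\mathsf{t}(g)}$. Topological groupoids. $\mathbf{G}$ is a topological space, $\mathbf{G}^{(0)}$ and $\mathbf{G}^{(2)}$ carry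 the topologies induced from $\mathbf{G}$ and $\mathbf{G}\times\mathbf{G}$, all structure maps are continuous, and $\mathsf{s},\mathsf{t}$ are surjective and open. All topological groupoids are assumed second countable, locally compact and Hausdorff. A continuous Haar system is a family $\lambda=\{\lambda^x\}_{x\in\mathbf{G}^{(0)}}$ of measures (standardly, Radon measures with full support on $\mathbf{G}^x$), $\lambda^x$ concentrated on $\mathbf{G}^x$, with $g\lambda^{\mathsf{s}(g)}=\lambda^{\mathsf{t}(g)}$ for all $g\in\mathbf{G}$, such that for every compactly supported continuous function $f$ on $\mathbf{G}$ the function $x\mapsto\langle\lambda^x,f\rangle$ is continuous on $\mathbf{G}^{(0)}$. Topological amenability. A system $\theta=\{\theta^x\}$ of probability measures on the fibers $\mathbf{G}^x$ is continuous if $x\mapsto\langle\theta^x,f\rangle$ is continuous for every compactly supported continuous $f$ on $\mathbf{G}$. $\mathbf{G}$ is topologically amenable if there is a sequence $\theta_n$ of continuous systems of probability measures on the fibers $\mathbf{G}^x$ such that $\|g\theta_n^{\mathsf{s}(g)}-\theta_n^{\mathsf{t}(g)}\|\to0$ (total variation norm) uniformly on compact subsets of $\mathbf{G}$. Markov operators. A Markov operator $P$ on a Borel space $X$ is given by a Borel family $\{\pi_x\}_{x\in X}$ of Borel probability measures on $X$ (transition probabilities) via $Pf(x)=\langle\pi_x,f\rangle$. If $m$ is a $\sigma$-finite measure on $X$ such that $\int\pi_x\,dm(x)$ is absolutely continuous with respect to $m$, then $P$ acts on $L^\infty(X,m)$, and it is called Liouville if every $f\in L^\infty(X,m)$ with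 $Pf=f$ is constant (a.e.). A Markov operator on $\mathbf{G}$ is invariant if its transition probabilities satisfy $\pi_{g'g}=g'\pi_g$ for all $(g',g)\in\mathbf{G}^{(2)}$; in particular $\pi_g$ is concentrated on $\mathbf{G}^{\mathsf{t}(g)}$, so $P$ restricts to Markov operators $P_x$ on the fibers $\mathbf{G}^x$. Such an operator is determined by the measures $\pi_x:=\pi_{\boldsymbol\varepsilon_x}$ on $\mathbf{G}^x$, since $\pi_g=g\pi_{\mathsf{s}(g)}$. "Continuous densities" means that $\pi_x$ is absolutely continuous with respect to $\lambda^x$ for every $x\in\mathbf{G}^{(0)}$, with density $\frac{d\pi_{\mathsf{t}(g)}}{d\lambda^{\mathsf{t}(g)}}(g)$ a continuous function of $g\in\mathbf{G}$. *)

theory Defs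
  imports "HOL-Probability.Probability"
begin

section \<open>Topological groupoids\<close>

text \<open>
  A groupoid is given by its set of morphisms, here the whole type; objects are identified with
  the identity morphisms, so \<open>src\<close> and \<open>tgt\<close> take values in the type of morphisms.
  The total function \<open>mul\<close> is meaningful only on pairs with \<open>src g = tgt h\<close>.
\<close>

record 'a groupoid_ops =
  src :: "'a \<Rightarrow> 'a"
  tgt :: "'a \<Rightarrow> 'a"
  mul :: "'a \<Rightarrow> 'a \<Rightarrow> 'a"
  inversion :: "'a \<Rightarrow> 'a"

definition units :: "('a, 'b) groupoid_ops_scheme \<Rightarrow> 'a set" where
  "units G = {x. src G x = x \<and> tgt G x = x}"

definition composable :: "('a, 'b) groupoid_ops_scheme \<Rightarrow> ('a \<times> 'a) set" where
  "composable G = {(g, h). src G g = tgt G h}"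

definition fiber :: "('a, 'b) groupoid_ops_scheme \<Rightarrow> 'a \<Rightarrow> 'a set" where
  "fiber G x = {g. tgt G g = x}"

locale groupoid =
  fixes G :: "('a, 'b) groupoid_ops_scheme" (structure)
  assumes src_unit: "src G g \<in> units G"
    and tgt_unit: "tgt G g \<in> units G"
    and src_mul: "src G g = tgt G h \<Longrightarrow> src G (mul G g h) = src G h"
    and tgt_mul: "src G g = tgt G h \<Longrightarrow> tgt G (mul G g h) = tgt G g"
    and mul_assoc: "src G g = tgt G h \<Longrightarrow> src G h = tgt G k \<Longrightarrow>
      mul G (mul G g h) k = mul G g (mul G h k)"
    and mul_src: "mul G g (src G g) = g"
    and tgt_mul_left: "mul G (tgt G g) g = g"
    and src_inversion: "src G (inversion G g) = tgt G g"
    and tgt_inversion: "tgt G (inversion G g) = src G g"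
    and mul_inversion: "mul G g (inversion G g) = tgt G g"
    and inversion_mul: "mul G (inversion G g) g = src G g"

text \<open>
  Surjectivity of \<open>src\<close> and \<open>tgt\<close> onto the units is automatic, and the map sending an object
  to its identity is the inclusion of the subspace \<open>units G\<close>, hence continuous.
  Openness refers to the topology that the space of objects inherits.
\<close>

locale topological_groupoid = groupoid G
  for G :: "('a :: {second_countable_topology, t2_space}, 'b) groupoid_ops_scheme" (structure) +
  assumes locally_compact: "locally_compact_space (euclidean :: 'a topology)"
    and continuous_src: "continuous_on UNIV (src G)"
    and continuous_tgt: "continuous_on UNIV (tgt G)"
    and continuous_mul: "continuous_on (composable G) (\<lambda>(g, h). mul G g h)"
    and continuous_inversion: "continuous_on UNIV (inversion G)"
    and open_src: "open_map euclidean (top_of_set (units G)) (src G)"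
    and open_tgt: "open_map euclidean (top_of_set (units G)) (tgt G)"


section \<open>Systems of measures on the fibers\<close>

text \<open>
  A measure on a fiber is represented by a Borel measure on the groupoid that is concentrated on
  the fiber (which is a closed set).
\<close>

definition measure_on_fiber :: "('a :: topological_space, 'b) groupoid_ops_scheme \<Rightarrow> 'a \<Rightarrow> 'a measure \<Rightarrow> bool" where
  "measure_on_fiber G x M \<longleftrightarrow> sets M = sets borel \<and> (AE h in M. h \<in> fiber G x)"

text \<open>
  \<open>translate G g \<theta>\<close> is the image of \<open>\<theta>\<close>, a measure on the fiber over \<open>src G g\<close>, under
  \<open>h \<mapsto> g h\<close>. The restriction is needed because \<open>mul G g\<close> is arbitrary (possibly not Borel)
  outside this fiber.
\<close>

definition translate :: "('a :: topological_space, 'b) groupoid_ops_scheme \<Rightarrow> 'a \<Rightarrow> 'a measure \<Rightarrow> 'a measure" where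
  "translate G g \<theta> = distr (restrict_space \<theta> (fiber G (src G g))) borel (mul G g)"

definition compactly_supported_continuous :: "('a :: topological_space \<Rightarrow> real) \<Rightarrow> bool" where
  "compactly_supported_continuous f \<longleftrightarrow>
     continuous_on UNIV f \<and> compact (closure {g. f g \<noteq> 0})"

definition continuous_system :: "('a :: topological_space, 'b) groupoid_ops_scheme \<Rightarrow> ('a \<Rightarrow> 'a measure) \<Rightarrow> bool" where
  "continuous_system G \<theta> \<longleftrightarrow>
     (\<forall>f. compactly_supported_continuous f \<longrightarrow>
        continuous_on (units G) (\<lambda>x. \<integral>h. f h \<partial>(\<theta> x)))"

definition radon_measure :: "'a :: topological_space measure \<Rightarrow> bool" where
  "radon_measure M \<longleftrightarrow>
     sets M = sets borel \<and>
     (\<forall>K. compact K \<longrightarrow> emeasure M K < \<infinity>) \<and>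
     (\<forall>A \<in> sets borel. emeasure M A = (INF U \<in> {U. open U \<and> A \<subseteq> U}. emeasure M U)) \<and>
     (\<forall>U. open U \<longrightarrow> emeasure M U = (SUP K \<in> {K. compact K \<and> K \<subseteq> U}. emeasure M K))"

definition haar_system :: "('a :: topological_space, 'b) groupoid_ops_scheme \<Rightarrow> ('a \<Rightarrow> 'a measure) \<Rightarrow> bool" where
  "haar_system G lam \<longleftrightarrow>
     (\<forall>x \<in> units G.
        radon_measure (lam x) \<and>
        measure_on_fiber G x (lam x) \<and>
        (\<forall>U. open U \<longrightarrow> U \<inter> fiber G x \<noteq> {} \<longrightarrow> 0 < emeasure (lam x) U)) \<and>
     (\<forall>g. translate G g (lam (src G g)) = lam (tgt G g)) \<and>
     continuous_system G lam"


section \<open>Topological amenability\<close>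

text \<open>The total variation norm of \<open>M - N\<close> for finite measures \<open>M\<close>, \<open>N\<close> on the same space.\<close>

definition total_variation_diff :: "'a measure \<Rightarrow> 'a measure \<Rightarrow> real" where
  "total_variation_diff M N =
     (SUP Q \<in> {Q. finite Q \<and> Q \<subseteq> sets M \<and> partition_on (space M) Q}.
        \<Sum>A\<in>Q. \<bar>measure M A - measure N A\<bar>)"

definition topologically_amenable :: "('a :: topological_space, 'b) groupoid_ops_scheme \<Rightarrow> bool" where
  "topologically_amenable G \<longleftrightarrow>
     (\<exists>\<theta> :: nat \<Rightarrow> 'a \<Rightarrow> 'a measure.
        (\<forall>n. \<forall>x \<in> units G. prob_space (\<theta> n x) \<and> measure_on_fiber G x (\<theta> n x)) \<and>
        (\<forall>n. continuous_system G (\<theta> n)) \<and>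
        (\<forall>K. compact K \<longrightarrow>
           uniform_limit K
             (\<lambda>n g. total_variation_diff (translate G g (\<theta> n (src G g))) (\<theta> n (tgt G g)))
             (\<lambda>g. 0) sequentially))"


section \<open>Markov operators\<close>

definition markov_kernel :: "'a measure \<Rightarrow> ('a \<Rightarrow> 'a measure) \<Rightarrow> bool" where
  "markov_kernel M \<pi> \<longleftrightarrow> \<pi> \<in> M \<rightarrow>\<^sub>M prob_algebra M"

definition markov_op :: "('a \<Rightarrow> 'a measure) \<Rightarrow> ('a \<Rightarrow> real) \<Rightarrow> 'a \<Rightarrow> real" where
  "markov_op \<pi> f x = (\<integral>y. f y \<partial>(\<pi> x))"

definition acts_on_Linfty :: "'a measure \<Rightarrow> ('a \<Rightarrow> 'a measure) \<Rightarrow> bool" where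
  "acts_on_Linfty M \<pi> \<longleftrightarrow>
     sigma_finite_measure M \<and> markov_kernel M \<pi> \<and>
     (\<forall>A \<in> null_sets M. (\<integral>\<^sup>+x. emeasure (\<pi> x) A \<partial>M) = 0)"

definition liouville :: "'a measure \<Rightarrow> ('a \<Rightarrow> 'a measure) \<Rightarrow> bool" where
  "liouville M \<pi> \<longleftrightarrow>
     acts_on_Linfty M \<pi> \<and>
     (\<forall>f :: 'a \<Rightarrow> real.
        f \<in> borel_measurable M \<longrightarrow>
        (\<exists>C. AE x in M. \<bar>f x\<bar> \<le> C) \<longrightarrow>
        (AE x in M. markov_op \<pi> f x = f x) \<longrightarrow>
        (\<exists>c. AE x in M. f x = c))"

definition invariant_markov_kernel :: "('a :: topological_space, 'b) groupoid_ops_scheme \<Rightarrow> ('a \<Rightarrow> 'a measure) \<Rightarrow> bool" where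
  "invariant_markov_kernel G \<pi> \<longleftrightarrow>
     markov_kernel borel \<pi> \<and>
     (\<forall>g. measure_on_fiber G (tgt G g) (\<pi> g)) \<and>
     (\<forall>(g', g) \<in> composable G. \<pi> (mul G g' g) = translate G g' (\<pi> g))"

text \<open>
  The function \<open>p\<close> is the density of \<open>\<pi> (tgt G g)\<close> with respect to \<open>lam (tgt G g)\<close>, evaluated
  at \<open>g\<close>.
\<close>

definition continuous_densities ::
  "('a :: topological_space, 'b) groupoid_ops_scheme \<Rightarrow> ('a \<Rightarrow> 'a measure) \<Rightarrow> ('a \<Rightarrow> 'a measure) \<Rightarrow> bool" where
  "continuous_densities G lam \<pi> \<longleftrightarrow>
     (\<exists>p :: 'a \<Rightarrow> real.
        continuous_on UNIV p \<and> (\<forall>g. 0 \<le> p g) \<and>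
        (\<forall>x \<in> units G. \<pi> x = density (lam x) (\<lambda>g. ennreal (p g))))"

definition fiber_measure :: "('a, 'b) groupoid_ops_scheme \<Rightarrow> ('a \<Rightarrow> 'a measure) \<Rightarrow> 'a \<Rightarrow> 'a measure" where
  "fiber_measure G lam x = restrict_space (lam x) (fiber G x)"

definition fiber_kernel :: "('a, 'b) groupoid_ops_scheme \<Rightarrow> ('a \<Rightarrow> 'a measure) \<Rightarrow> 'a \<Rightarrow> 'a \<Rightarrow> 'a measure" where
  "fiber_kernel G \<pi> x h = restrict_space (\<pi> h) (fiber G x)"

definition topologically_fiberwise_liouville ::
  "('a, 'b) groupoid_ops_scheme \<Rightarrow> ('a \<Rightarrow> 'a measure) \<Rightarrow> ('a \<Rightarrow> 'a measure) \<Rightarrow> bool" where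
  "topologically_fiberwise_liouville G lam \<pi> \<longleftrightarrow>
     (\<forall>x \<in> units G. liouville (fiber_measure G lam x) (fiber_kernel G \<pi> x))"


section \<open>The fiberwise operators act on bounded functions\<close>

text \<open>
  The clause \<open>acts_on_Linfty\<close> in the definition of the Liouville property is automatic for the
  fiberwise operators of an invariant Markov operator with continuous densities.
\<close>

lemma (in topological_groupoid) fiber_borel: "fiber G x \<in> sets borel"
proof -
  have "closed (tgt G -` {x})"
    by (rule closed_vimage[OF closed_singleton continuous_tgt])
  also have "tgt G -` {x} = fiber G x" by (auto simp: fiber_def)
  finally show ?thesis by (rule borel_closed)
qed

lemma (in topological_groupoid) mul_measurable:
  "mul G g \<in> restrict_space borel (fiber G (src G g)) \<rightarrow>\<^sub>M borel"
proof -
  have "continuous_on (fiber G (src G g)) (\<lambda>h. (\<lambda>(g, h). mul G g h) (g, h))"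
    by (rule continuous_on_compose2[OF continuous_mul])
       (auto intro!: continuous_intros simp: composable_def fiber_def)
  then show ?thesis by (intro borel_measurable_continuous_on_restrict) simp
qed

lemma (in topological_groupoid) emeasure_translate:
  assumes M: "sets M = sets borel" and A: "A \<in> sets borel"
  shows "emeasure (translate G g M) A = emeasure M (mul G g -` A \<inter> fiber G (src G g))"
    and "mul G g -` A \<inter> fiber G (src G g) \<in> sets borel"
proof -
  let ?F = "fiber G (src G g)"
  have sp: "space M = UNIV" using sets_eq_imp_space_eq[OF M] by simp
  have F: "?F \<in> sets M" using fiber_borel M by simp
  have m: "mul G g \<in> restrict_space M ?F \<rightarrow>\<^sub>M borel"
    using mul_measurable[of g] by (simp add: M cong: measurable_cong_sets sets_restrict_space_cong)
  have "mul G g -` A \<inter> space (restrict_space M ?F) \<in> sets (restrict_space M ?F)"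
    using measurable_sets[OF m A] .
  then have s: "mul G g -` A \<inter> ?F \<in> sets M"
    using F by (simp add: space_restrict_space sp sets_restrict_space_iff)
  then show "mul G g -` A \<inter> ?F \<in> sets borel" using M by simp
  show "emeasure (translate G g M) A = emeasure M (mul G g -` A \<inter> ?F)"
    unfolding translate_def
    by (subst emeasure_distr[OF m A])
       (use F in \<open>simp add: space_restrict_space sp emeasure_restrict_space\<close>)
qed

lemma (in topological_groupoid) invariant_null_sets:
  assumes H: "haar_system G lam" and I: "invariant_markov_kernel G \<pi>"
    and D: "continuous_densities G lam \<pi>" and A: "A \<in> null_sets (lam (tgt G h))"
  shows "emeasure (\<pi> h) A = 0"
proof -
  let ?x = "src G h"
  have x: "?x \<in> units G" by (rule src_unit)
  have sl: "sets (lam y) = sets borel" if "y \<in> units G" for y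
    using H that by (auto simp: haar_system_def radon_measure_def)
  have A': "A \<in> sets borel" using A sl[OF tgt_unit] by auto
  have tx: "tgt G ?x = ?x" using x by (auto simp: units_def)
  have eq: "\<pi> h = translate G h (\<pi> ?x)"
  proof -
    have "(h, ?x) \<in> composable G" using tx by (simp add: composable_def)
    then have "\<pi> (mul G h ?x) = translate G h (\<pi> ?x)"
      using I unfolding invariant_markov_kernel_def by blast
    then show ?thesis by (simp add: mul_src)
  qed
  have sp: "sets (\<pi> ?x) = sets borel"
    using I by (auto simp: invariant_markov_kernel_def measure_on_fiber_def)
  let ?B = "mul G h -` A \<inter> fiber G ?x"
  have "emeasure (lam (tgt G h)) A = 0" using A by auto
  moreover have "lam (tgt G h) = translate G h (lam ?x)" using H by (simp add: haar_system_def)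
  ultimately have "emeasure (lam ?x) ?B = 0" using emeasure_translate(1)[OF sl[OF x] A', of h] by simp
  then have B: "?B \<in> null_sets (lam ?x)"
    using emeasure_translate(2)[OF sl[OF x] A', of h] sl[OF x] by auto
  obtain p where p: "continuous_on UNIV p" "\<pi> ?x = density (lam ?x) (\<lambda>g. ennreal (p g))"
    using D x unfolding continuous_densities_def by auto
  have "p \<in> borel_measurable (lam ?x)"
    using borel_measurable_continuous_onI[OF p(1)] sl[OF x] by (simp cong: measurable_cong_sets)
  then have "absolutely_continuous (lam ?x) (\<pi> ?x)"
    unfolding p(2) by (intro absolutely_continuousI_density) simp
  then have "emeasure (\<pi> ?x) ?B = 0" using B by (auto simp: absolutely_continuous_def)
  then show ?thesis using emeasure_translate(1)[OF sp A', of h] eq by simp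
qed

lemma (in topological_groupoid) sigma_finite_haar:
  assumes H: "haar_system G lam" and x: "x \<in> units G"
  shows "sigma_finite_measure (lam x)"
proof -
  have sl: "sets (lam x) = sets borel" and fin: "\<And>K. compact K \<Longrightarrow> emeasure (lam x) K < \<infinity>"
    using H x by (auto simp: haar_system_def radon_measure_def)
  define B where "B = {U :: 'a set. open U \<and> (\<exists>K. compact K \<and> U \<subseteq> K)}"
  have U: "\<Union>B = UNIV"
  proof -
    have "\<exists>U\<in>B. y \<in> U" for y
    proof -
      obtain U K where "open U" "compact K" "y \<in> U" "U \<subseteq> K"
        using locally_compact unfolding locally_compact_space_def
        by (metis UNIV_I compactin_euclidean_iff open_openin topspace_euclidean)
      then show ?thesis unfolding B_def by blast
    qed
    then show ?thesis by blast
  qed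
  obtain C where C: "C \<subseteq> B" "countable C" "\<Union>C = \<Union>B"
    using Lindelof[of B] unfolding B_def by blast
  have f: "emeasure (lam x) U \<noteq> \<infinity>" if U_B: "U \<in> B" for U
  proof -
    obtain K where K: "compact K" "U \<subseteq> K" using U_B by (auto simp: B_def)
    have "emeasure (lam x) U \<le> emeasure (lam x) K"
      by (rule emeasure_mono) (use K sl borel_compact in auto)
    then show ?thesis using fin[OF K(1)] by (auto simp: top_unique)
  qed
  show ?thesis
  proof
    show "\<exists>A. countable A \<and> A \<subseteq> sets (lam x) \<and> \<Union> A = space (lam x) \<and> (\<forall>a\<in>A. emeasure (lam x) a \<noteq> \<infinity>)"
    proof (intro exI[of _ C] conjI ballI)
      show "C \<subseteq> sets (lam x)" using C(1) sl by (auto simp: B_def)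
      show "\<Union>C = space (lam x)" using C(3) U sets_eq_imp_space_eq[OF sl] by simp
      show "emeasure (lam x) a \<noteq> \<infinity>" if "a \<in> C" for a using f C(1) that by blast
    qed (rule C(2))
  qed
qed

proposition (in topological_groupoid) fiberwise_acts_on_Linfty:
  assumes H: "haar_system G lam" and I: "invariant_markov_kernel G \<pi>"
    and D: "continuous_densities G lam \<pi>" and x: "x \<in> units G"
  shows "acts_on_Linfty (fiber_measure G lam x) (fiber_kernel G \<pi> x)"
proof -
  let ?F = "fiber G x"
  let ?R = "restrict_space (borel :: 'a measure) ?F"
  have F: "?F \<in> sets borel" by (rule fiber_borel)
  have sl: "sets (lam x) = sets borel"
    using H x by (auto simp: haar_system_def radon_measure_def)
  have spl: "space (lam x) = UNIV" using sets_eq_imp_space_eq[OF sl] by simp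
  have sR: "sets (fiber_measure G lam x) = sets ?R"
    unfolding fiber_measure_def using sl by (rule sets_restrict_space_cong)
  have spR: "space ?R = ?F" by (simp add: space_restrict_space)
  have k: "\<pi> \<in> borel \<rightarrow>\<^sub>M prob_algebra borel"
    using I by (simp add: invariant_markov_kernel_def markov_kernel_def)
  have pk: "prob_space (\<pi> h)" "sets (\<pi> h) = sets borel" for h
    using measurable_space[OF k, of h] by (auto simp: space_prob_algebra)
  have spk: "space (\<pi> h) = UNIV" for h using sets_eq_imp_space_eq[OF pk(2)] by simp
  have conc: "AE y in \<pi> h. y \<in> ?F" if "h \<in> ?F" for h
    using I that by (auto simp: invariant_markov_kernel_def measure_on_fiber_def fiber_def)
  have prob: "prob_space (fiber_kernel G \<pi> x h)" if "h \<in> ?F" for h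
  proof -
    interpret prob_space "\<pi> h" by (rule pk)
    have "emeasure (\<pi> h) ?F = 1"
      by (rule emeasure_eq_1_AE) (use F pk conc[OF that] in auto)
    then show ?thesis unfolding fiber_kernel_def
      by (intro prob_spaceI)
         (use F pk(2) in \<open>simp add: space_restrict_space spk emeasure_restrict_space\<close>)
  qed
  have em: "emeasure (fiber_kernel G \<pi> x h) A = emeasure (\<pi> h) A" if "A \<in> sets ?R" for A h
    unfolding fiber_kernel_def
    by (rule emeasure_restrict_space) (use that F pk(2) in \<open>auto simp: sets_restrict_space spk\<close>)
  have bor: "A \<in> sets borel" if "A \<in> sets ?R" for A
    using that F by (auto simp: sets_restrict_space)
  have "fiber_kernel G \<pi> x \<in> ?R \<rightarrow>\<^sub>M subprob_algebra ?R"
  proof (rule measurable_subprob_algebra)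
    fix h assume "h \<in> space ?R"
    then show "subprob_space (fiber_kernel G \<pi> x h)"
      using prob[of h] spR prob_space_imp_subprob_space by auto
    show "sets (fiber_kernel G \<pi> x h) = sets ?R"
      unfolding fiber_kernel_def using pk(2) by (rule sets_restrict_space_cong)
  next
    fix A assume A: "A \<in> sets ?R"
    have "(\<lambda>h. emeasure (\<pi> h) A) \<in> borel_measurable borel"
      using measurable_emeasure_kernel[OF measurable_prob_algebraD[OF k] bor[OF A]] .
    then show "(\<lambda>h. emeasure (fiber_kernel G \<pi> x h) A) \<in> borel_measurable ?R"
      unfolding em[OF A] by (rule measurable_restrict_space1)
  qed
  then have "fiber_kernel G \<pi> x \<in> ?R \<rightarrow>\<^sub>M prob_algebra ?R"
    using prob spR by (intro measurable_prob_algebraI) auto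
  moreover have "sets (prob_algebra (fiber_measure G lam x)) = sets (prob_algebra ?R)"
    unfolding prob_algebra_def using subprob_algebra_cong[OF sR] by simp
  ultimately have mk: "markov_kernel (fiber_measure G lam x) (fiber_kernel G \<pi> x)"
    unfolding markov_kernel_def by (subst measurable_cong_sets[OF sR]) auto
  have sf: "sigma_finite_measure (fiber_measure G lam x)"
    unfolding fiber_measure_def
    by (rule sigma_finite_measure_restrict_space[OF sigma_finite_haar[OF H x]]) (use F sl in auto)
  have "(\<integral>\<^sup>+h. emeasure (fiber_kernel G \<pi> x h) A \<partial>(fiber_measure G lam x)) = 0"
    if A: "A \<in> null_sets (fiber_measure G lam x)" for A
  proof -
    have A': "A \<in> sets ?R" using A sR by auto
    have "A \<in> null_sets (lam x)"
      using A F sl unfolding fiber_measure_def by (subst (asm) null_sets_restrict_space) auto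
    then have "emeasure (fiber_kernel G \<pi> x h) A = 0" if "h \<in> ?F" for h
      using invariant_null_sets[OF H I D, of A h] that by (simp add: em[OF A'] fiber_def)
    then have "(\<integral>\<^sup>+h. emeasure (fiber_kernel G \<pi> x h) A \<partial>(fiber_measure G lam x))
      = (\<integral>\<^sup>+h. 0 \<partial>(fiber_measure G lam x))"
      by (intro nn_integral_cong) (simp add: fiber_measure_def space_restrict_space)
    then show ?thesis by simp
  qed
  with mk sf show ?thesis by (simp add: acts_on_Linfty_def)
qed

end

theory Submission
  imports Defs
begin

text \<open>
Write \<open>P\<close> for the Markov operator and \<open>A n\<close> for the average of \<open>P ^ k\<close> over \<open>k < 2 ^ n\<close>. The
approximately invariant measures are \<open>theta n x\<close>, the law at a random time, uniform in
\<open>{1..2 ^ n}\<close>, of the Markov chain that starts at the unit \<open>x\<close>; thus \<open>theta n x\<close> integrates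
\<open>f\<close> to \<open>P (A n f) x\<close>. By invariance the translate of \<open>theta n (src g)\<close> by \<open>g\<close> is the same
law for the chain that starts at \<open>g\<close>. The total variation distance to be estimated is therefore
controlled by the deviation at \<open>g\<close>, the supremum of
\<open>\<bar>P (A n f) g - P (A n f) (tgt g)\<bar>\<close> over Borel functions \<open>f\<close> with values in \<open>[0, 1]\<close>. It tends
to zero uniformly on compact sets for three reasons, combined as in Dini's theorem.

The deviation is decreasing in \<open>n\<close>, because \<open>A (n + 1) f\<close> is \<open>A n\<close> applied to the mean of \<open>f\<close>
and \<open>P ^ (2 ^ n) f\<close> (\<open>deviation_le_mono\<close>). This is why the averages are dyadic.

For each \<open>g\<close> it tends to zero (\<open>exists_deviation_le\<close>). Otherwise there are functions
\<open>v n = A n (f n)\<close> that \<open>P\<close> moves by at most \<open>1 / 2 ^ n\<close> and for which \<open>P (v n)\<close> separates \<open>g\<close>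
from \<open>tgt g\<close> by a fixed amount. These conditions are convex, so that a Hilbert space argument
(\<open>midpoint_convex_AE_Cauchy\<close>) provides an almost everywhere convergent sequence of such
functions. Its limit is a bounded harmonic function on the fiber. By the Liouville property it is
constant almost everywhere, which contradicts the separation since the transition probabilities
from \<open>g\<close> and \<open>tgt g\<close> are absolutely continuous.

For fixed \<open>n\<close> it is upper semicontinuous in \<open>g\<close> (\<open>deviation_le_locally\<close>). Here the
continuity of the densities enters. Cutting the density \<open>p\<close> off outside a large compact set and
convolving gives a continuous compactly supported function \<open>q\<close> below the density of every
\<open>theta n x\<close>, whose mass is close to one on a prescribed compact set of units
(\<open>exists_subdensity\<close>). By \<open>continuous_fiber_integral\<close> the distance between \<open>q\<close> and its translate
by \<open>g\<close> is continuous in \<open>g\<close>; up to the missing mass it lies between the deviation and twice the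
deviation (\<open>deviation_estimates\<close>). The same functions \<open>q\<close> show that \<open>theta n\<close> is a continuous system.
\<close>

section \<open>Almost everywhere convergence in midpoint convex sets\<close>

text \<open>
In a decreasing sequence of convex sets choose elements of almost minimal \<open>L\<^sup>2\<close> norm. The minimal
norms increase to a finite limit, so the parallelogram law makes the chosen elements a Cauchy
sequence in \<open>L\<^sup>2\<close>, hence in \<open>L\<^sup>1\<close>, and a subsequence converges almost everywhere. This replaces
weak compactness whenever the property wanted of the limit is a convex condition.
\<close>

lemma midpoint_convex_AE_Cauchy:
  fixes C :: "nat \<Rightarrow> ('a \<Rightarrow> real) set"
  assumes "finite_measure M" and "decseq C" and ne: "\<And>n. C n \<noteq> {}"
    and meas: "\<And>n v. v \<in> C n \<Longrightarrow> v \<in> borel_measurable M"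
    and bd: "\<And>n v x. v \<in> C n \<Longrightarrow> 0 \<le> v x \<and> v x \<le> 1"
    and mid: "\<And>n u v. u \<in> C n \<Longrightarrow> v \<in> C n \<Longrightarrow> (\<lambda>x. (u x + v x) / 2) \<in> C n"
  obtains w where "\<And>k. w k \<in> C k" and "AE x in M. Cauchy (\<lambda>k. w k x)"
proof -
  interpret finite_measure M by fact
  define I where "I v = (\<integral>x. (v x)\<^sup>2 \<partial>M)" for v :: "'a \<Rightarrow> real"
  define d where "d n = Inf (I ` C n)" for n
  let ?m = "measure M (space M)"
  have sub: "C m \<subseteq> C n" if "n \<le> m" for n m
    using \<open>decseq C\<close> that by (auto simp: decseq_def)
  have bnd: "integrable M f" if "f \<in> borel_measurable M" "\<And>x. \<bar>f x\<bar> \<le> 4" for f :: "'a \<Rightarrow> real"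
    by (rule integrable_const_bound[of _ 4]) (use that in auto)
  have sq_le: "(v x)\<^sup>2 \<le> 1" if "v \<in> C n" for n v x
    using bd[OF that, of x] by (simp add: power_le_one)
  have int_sq: "integrable M (\<lambda>x. (v x)\<^sup>2)" if "v \<in> C n" for n v
    by (rule bnd) (use meas[OF that] in \<open>auto intro: order_trans[OF sq_le[OF that]]\<close>)
  have I_nonneg: "0 \<le> I v" for v unfolding I_def by simp
  have I_le: "I v \<le> ?m" if "v \<in> C n" for v n
  proof -
    have "I v \<le> (\<integral>x. 1 \<partial>M)" unfolding I_def
      by (rule integral_mono) (use int_sq[OF that] sq_le[OF that] in auto)
    then show ?thesis by simp
  qed
  have d_le: "d n \<le> I v" if "v \<in> C n" for n v
    unfolding d_def by (rule cInf_lower) (use that I_nonneg in \<open>auto intro!: bdd_belowI[of _ 0]\<close>)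
  have "incseq d" unfolding incseq_def d_def
    by (intro allI impI cInf_superset_mono image_mono sub)
       (use ne I_nonneg in \<open>auto intro!: bdd_belowI[of _ 0]\<close>)
  moreover have "d n \<le> ?m" for n using ne[of n] d_le I_le by (meson all_not_in_conv order_trans)
  ultimately have "convergent d"
    using incseq_convergent[of d ?m] unfolding convergent_def by metis
  then have cau_d: "Cauchy d" by (rule convergent_Cauchy)
  have "\<exists>v\<in>C n. I v < d n + 1 / (real n + 1)" for n
  proof -
    have "Inf (I ` C n) < d n + 1 / (real n + 1)" unfolding d_def by simp
    then show ?thesis using ne[of n] by (subst (asm) cInf_less_iff) (auto intro!: bdd_belowI[of _ 0] simp: I_nonneg)
  qed
  then obtain v where v: "\<And>n. v n \<in> C n" and vI: "\<And>n. I (v n) < d n + 1 / (real n + 1)"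
    by metis
  note [measurable] = meas[OF v]
  have v_abs: "\<bar>v n x - v m x\<bar> \<le> 1" for n m x using bd[OF v[of n], of x] bd[OF v[of m], of x] by auto
  then have v_sq: "(v n x - v m x)\<^sup>2 \<le> 1" for n m x by (simp add: abs_square_le_1)
  have int_d: "integrable M (\<lambda>x. (v n x - v m x)\<^sup>2)" for n m
    by (rule bnd) (auto intro: order_trans[OF v_sq])
  have int_a: "integrable M (\<lambda>x. \<bar>v n x - v m x\<bar>)" for n m
    by (rule bnd) (auto intro: order_trans[OF v_abs])
  \<comment> \<open>Parallelogram law: the midpoint lies in the larger set \<open>C n\<close>, so its squared norm is at least \<open>d n\<close>.\<close>
  have key: "(\<integral>x. (v n x - v m x)\<^sup>2 \<partial>M) \<le> 2 * (d m - d n) + 4 / (real n + 1)" if nm: "n \<le> m" for n m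
  proof -
    let ?c = "\<lambda>x. (v n x + v m x) / 2"
    have cC: "?c \<in> C n" using mid v[of n] v[of m] sub[OF nm] by blast
    have "(\<integral>x. (v n x - v m x)\<^sup>2 \<partial>M) = (\<integral>x. 2 * (v n x)\<^sup>2 + 2 * (v m x)\<^sup>2 - 4 * (?c x)\<^sup>2 \<partial>M)"
      by (rule Bochner_Integration.integral_cong) (auto simp: power2_eq_square field_simps)
    also have "\<dots> = 2 * I (v n) + 2 * I (v m) - 4 * I ?c"
      unfolding I_def using int_sq[OF v[of n]] int_sq[OF v[of m]] int_sq[OF cC] by simp
    also have "\<dots> \<le> 2 * (d n + 1 / (real n + 1)) + 2 * (d m + 1 / (real m + 1)) - 4 * d n"
      using vI[of n] vI[of m] d_le[OF cC] by argo
    also have "\<dots> \<le> 2 * (d m - d n) + 4 / (real n + 1)"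
    proof -
      have "1 / (real m + 1) \<le> 1 / (real n + 1)" using nm by (intro frac_le) auto
      then show ?thesis by argo
    qed
    finally show ?thesis .
  qed
  have cau: "\<exists>N. \<forall>i\<ge>N. \<forall>j\<ge>N. (\<integral>x. norm (v i x - v j x) \<partial>M) < e" if e: "e > 0" for e
  proof -
    \<comment> \<open>The bound \<open>\<bar>a\<bar> \<le> t + a\<^sup>2 / t\<close> turns \<open>L\<^sup>2\<close> estimates into \<open>L\<^sup>1\<close> estimates.\<close>
    define t where "t = e / (2 * (?m + 1))"
    have t: "t > 0" "t * ?m < e / 2" using e unfolding t_def by (auto simp: field_simps add_pos_nonneg)
    obtain N1 where N1: "\<forall>i\<ge>N1. \<forall>j\<ge>N1. \<bar>d i - d j\<bar> < t * e / 8"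
      using cau_d t e unfolding Cauchy_def dist_real_def by (metis divide_pos_pos mult_pos_pos zero_less_numeral)
    obtain N2 where N2: "16 / (t * e) < real N2" using reals_Archimedean2 by blast
    have *: "(\<integral>x. \<bar>v i x - v j x\<bar> \<partial>M) < e" if ij: "i \<le> j" "i \<ge> max N1 N2" for i j
    proof -
      have "16 / (t * e) < real i + 1" using N2 ij by linarith
      then have "4 / (real i + 1) \<le> t * e / 4" using t e by (simp add: field_simps)
      moreover have "\<bar>d j - d i\<bar> < t * e / 8" using N1 ij by auto
      ultimately have k: "(\<integral>x. (v i x - v j x)\<^sup>2 \<partial>M) \<le> t * e / 2"
        using key[OF ij(1)] by argo
      have "(\<integral>x. \<bar>v i x - v j x\<bar> \<partial>M) \<le> (\<integral>x. t + (v i x - v j x)\<^sup>2 / t \<partial>M)"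
      proof (rule integral_mono)
        show "\<bar>v i x - v j x\<bar> \<le> t + (v i x - v j x)\<^sup>2 / t" for x
        proof -
          have "\<bar>a\<bar> * t \<le> t * t + a\<^sup>2" for a :: real
          proof -
            have "(t - \<bar>a\<bar>)\<^sup>2 = t * t - 2 * (\<bar>a\<bar> * t) + a\<^sup>2"
              by (simp add: power2_eq_square algebra_simps)
            moreover have "0 \<le> (t - \<bar>a\<bar>)\<^sup>2" "0 \<le> \<bar>a\<bar> * t" using t(1) by auto
            ultimately show ?thesis by argo
          qed
          then show ?thesis using t(1) by (simp add: field_simps)
        qed
      qed (use int_d int_a in auto)
      also have "\<dots> = t * ?m + (\<integral>x. (v i x - v j x)\<^sup>2 \<partial>M) / t"
        using int_d by simp
      also have "\<dots> \<le> t * ?m + (t * e / 2) / t"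
        using k t by (intro add_left_mono divide_right_mono) auto
      also have "\<dots> < e" using t by simp
      finally show ?thesis .
    qed
    have "(\<integral>x. norm (v i x - v j x) \<partial>M) < e" if "i \<ge> max N1 N2" "j \<ge> max N1 N2" for i j
    proof (cases "i \<le> j")
      case True then show ?thesis using * that by simp
    next
      case False
      then have "(\<integral>x. \<bar>v j x - v i x\<bar> \<partial>M) < e" using * that by simp
      then show ?thesis by (simp add: abs_minus_commute)
    qed
    then show ?thesis by blast
  qed
  have "integrable M (v n)" for n
    by (rule bnd) (use bd[OF v[of n]] in \<open>auto simp: abs_of_nonneg intro: order_trans[of _ 1]\<close>)
  then obtain r where r: "strict_mono r" "AE x in M. Cauchy (\<lambda>i. v (r i) x)"
    using cauchy_L1_AE_cauchy_subseq[of M v] cau by blast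
  have "v (r k) \<in> C k" for k
    using v[of "r k"] sub[OF seq_suble[OF r(1), of k]] by blast
  with r(2) show thesis using that[of "\<lambda>k. v (r k)"] by blast
qed

section \<open>Cutoff functions and extension in locally compact spaces\<close>

lemma normal_space_euclidean:
  assumes "locally_compact_space (euclidean :: 'a::{second_countable_topology, t2_space} topology)"
  shows "normal_space (euclidean :: 'a topology)"
proof (rule regular_Lindelof_imp_normal_space)
  show "regular_space (euclidean :: 'a topology)"
    by (rule locally_compact_Hausdorff_imp_regular_space[OF assms])
       (use hausdorff in \<open>auto simp: Hausdorff_space_def disjnt_def\<close>)
  have "second_countable (euclidean :: 'a topology)"
  proof -
    obtain B :: "'a set set" where "countable B" "topological_basis B"
      using ex_countable_basis by blast
    then have "\<forall>V\<in>B. openin euclidean V"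
      "\<forall>U x. openin euclidean U \<and> x \<in> U \<longrightarrow> (\<exists>V\<in>B. x \<in> V \<and> V \<subseteq> U)"
      unfolding topological_basis_def open_openin[symmetric] by blast+
    with \<open>countable B\<close> show ?thesis unfolding second_countable_def by blast
  qed
  then show "Lindelof_space (euclidean :: 'a topology)"
    by (rule second_countable_imp_Lindelof_space)
qed

lemma compact_neighbourhood:
  fixes K :: "'a::{second_countable_topology, t2_space} set"
  assumes lc: "locally_compact_space (euclidean :: 'a topology)" and K: "compact K"
  obtains U L where "open U" "compact L" "K \<subseteq> U" "U \<subseteq> L"
proof -
  have "\<forall>x :: 'a. \<exists>U L. open U \<and> compact L \<and> x \<in> U \<and> U \<subseteq> L"
    using lc unfolding locally_compact_space_def
    by (metis UNIV_I compactin_euclidean_iff open_openin topspace_euclidean)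
  from choice[OF this] obtain U :: "'a \<Rightarrow> 'a set"
    where U: "\<forall>x. \<exists>L. open (U x) \<and> compact L \<and> x \<in> U x \<and> U x \<subseteq> L" by (rule exE)
  from choice[OF U] obtain L :: "'a \<Rightarrow> 'a set"
    where L: "\<forall>x. open (U x) \<and> compact (L x) \<and> x \<in> U x \<and> U x \<subseteq> L x" by (rule exE)
  have UL: "open (U x)" "compact (L x)" "x \<in> U x" "U x \<subseteq> L x" for x
    using L[rule_format, of x] by simp_all
  obtain D where D: "D \<subseteq> K" "finite D" "K \<subseteq> (\<Union>x\<in>D. U x)"
  proof (rule compactE_image[OF K, of K U])
    show "open (U x)" for x by (rule UL(1))
    show "K \<subseteq> (\<Union>x\<in>K. U x)" using UL(3) by (auto intro: UN_I)
  qed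
  show thesis
  proof (rule that[of "\<Union>x\<in>D. U x" "\<Union>x\<in>D. L x"])
    show "open (\<Union>x\<in>D. U x)" using UL(1) by (rule open_UN[OF ballI])
    show "compact (\<Union>x\<in>D. L x)" using D(2) UL(2) by (rule compact_UN)
    show "(\<Union>x\<in>D. U x) \<subseteq> (\<Union>x\<in>D. L x)" using UL(4) by (rule UN_mono[OF subset_refl])
  qed (rule D(3))
qed

lemma cutoff_function:
  fixes K :: "'a::{second_countable_topology, t2_space} set"
  assumes lc: "locally_compact_space (euclidean :: 'a topology)" and K: "compact K"
  obtains \<phi> :: "'a \<Rightarrow> real" where "compactly_supported_continuous \<phi>" "\<And>x. 0 \<le> \<phi> x" "\<And>x. \<phi> x \<le> 1"
    "\<And>x. x \<in> K \<Longrightarrow> \<phi> x = 1"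
proof -
  obtain U L where UL: "open U" "compact L" "K \<subseteq> U" "U \<subseteq> L" using compact_neighbourhood[OF lc K] by blast
  have "closedin euclidean K" "closedin euclidean (- U)" "disjnt (-U) K"
    using compact_imp_closed[OF K] UL by (auto simp: disjnt_def)
  then obtain f where f: "continuous_map euclidean (top_of_set {0..1::real}) f" "f ` (-U) \<subseteq> {0}" "f ` K \<subseteq> {1}"
    using Urysohn_lemma[OF normal_space_euclidean[OF lc], of "-U" K 0 1] by auto
  have "{x. f x \<noteq> 0} \<subseteq> L" using f(2) UL by auto
  then have cl: "closure {x. f x \<noteq> 0} \<subseteq> L" using compact_imp_closed[OF UL(2)] by (rule closure_minimal)
  have "compact (closure {x. f x \<noteq> 0})"
    using compact_Int_closed[OF UL(2) closed_closure, of "{x. f x \<noteq> 0}"] cl by (simp add: inf.absorb2)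
  moreover have cont: "continuous_on UNIV f" and rng: "f x \<in> {0..1}" for x
    using f(1) by (auto simp: continuous_map_in_subtopology)
  ultimately have csc: "compactly_supported_continuous f"
    unfolding compactly_supported_continuous_def by blast
  show thesis
  proof (rule that[OF csc])
    show "0 \<le> f x" "f x \<le> 1" for x using rng[of x] by simp_all
    show "f x = 1" if "x \<in> K" for x using f(3) that by (auto dest: imageI)
  qed
qed

text \<open>
Needed for the fact that a finite Borel measure is almost carried by a compact set.
\<close>

lemma compact_exhaustion:
  assumes lc: "locally_compact_space (euclidean :: 'a::{second_countable_topology, t2_space} topology)"
  obtains K :: "nat \<Rightarrow> 'a::{second_countable_topology, t2_space} set" where "\<And>n. compact (K n)" "incseq K" "(\<Union>n. K n) = UNIV"
proof -
  define B where "B = {U :: 'a set. open U \<and> (\<exists>L. compact L \<and> U \<subseteq> L)}"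
  have U: "\<Union>B = UNIV"
  proof -
    have "\<exists>U\<in>B. x \<in> U" for x
    proof -
      obtain U L where "open U" "compact L" "{x} \<subseteq> U" "U \<subseteq> L"
        using compact_neighbourhood[OF lc compact_sing, of x] by metis
      then show ?thesis unfolding B_def by blast
    qed
    then show ?thesis by blast
  qed
  obtain C where C: "C \<subseteq> B" "countable C" "\<Union>C = UNIV"
    using Lindelof[of B] U unfolding B_def by (smt (verit) mem_Collect_eq)
  then have "C \<noteq> {}" by auto
  then have rC: "range (from_nat_into C) = C" using C(2) by (rule range_from_nat_into)
  have "\<exists>L. compact L \<and> from_nat_into C i \<subseteq> L" for i
    using rC C(1) unfolding B_def by blast
  then obtain L where L: "\<And>i. compact (L i)" "\<And>i. from_nat_into C i \<subseteq> L i" by metis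
  show thesis
  proof (rule that[of "\<lambda>n. \<Union>i\<le>n. L i"])
    show "(\<Union>n. \<Union>i\<le>n. L i) = UNIV" 
    proof -
      have "\<exists>n. x \<in> L n" for x
      proof -
        obtain V where V: "V \<in> C" "x \<in> V" using C(3) by blast
        then obtain n where "from_nat_into C n = V" using rC by (metis imageE)
        then show ?thesis using L(2) V(2) by blast
      qed
      then show ?thesis by blast
    qed
    show "incseq (\<lambda>n. \<Union>i\<le>n. L i)" by (rule incseq_SucI) (auto simp: atMost_Suc)
    show "compact (\<Union>i\<le>n. L i)" for n by (rule compact_UN[OF finite_atMost L(1)])
  qed
qed

lemma continuous_on_UNIV_iff_nhds:
  "continuous_on UNIV f \<longleftrightarrow> (\<forall>x. (f \<longlongrightarrow> f x) (nhds x))"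
  by (simp add: continuous_on_def tendsto_at_iff_tendsto_nhds)

lemma compactly_supported_continuous_iff:
  fixes f :: "'a::t2_space \<Rightarrow> real"
  shows "compactly_supported_continuous f \<longleftrightarrow>
    continuous_on UNIV f \<and> (\<exists>L. compact L \<and> (\<forall>x. x \<notin> L \<longrightarrow> f x = 0))"
proof (intro iffI conjI)
  assume "compactly_supported_continuous f"
  then show "continuous_on UNIV f" "\<exists>L. compact L \<and> (\<forall>x. x \<notin> L \<longrightarrow> f x = 0)"
    using closure_subset[of "{g. f g \<noteq> 0}"]
    by (auto simp: compactly_supported_continuous_def intro!: exI[of _ "closure {g. f g \<noteq> 0}"])
next
  assume "continuous_on UNIV f \<and> (\<exists>L. compact L \<and> (\<forall>x. x \<notin> L \<longrightarrow> f x = 0))"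
  then obtain L where L: "compact L" "\<And>x. x \<notin> L \<Longrightarrow> f x = 0" and c: "continuous_on UNIV f" by blast
  have "closure {g. f g \<noteq> 0} \<subseteq> L"
    by (rule closure_minimal) (use L compact_imp_closed in auto)
  then have "compact (closure {g. f g \<noteq> 0})"
    using compact_Int_closed[OF L(1) closed_closure, of "{g. f g \<noteq> 0}"] by (simp add: inf.absorb2)
  with c show "compactly_supported_continuous f" by (simp add: compactly_supported_continuous_def)
qed

lemma compactly_supported_continuous_mult:
  fixes f g :: "'a::t2_space \<Rightarrow> real"
  assumes "continuous_on UNIV f" and "compactly_supported_continuous g"
  shows "compactly_supported_continuous (\<lambda>x. f x * g x)"
  using assms unfolding compactly_supported_continuous_iff
  by (auto intro!: continuous_intros)

lemma compactly_supported_continuous_zero: "compactly_supported_continuous (\<lambda>x::'a::t2_space. 0)"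
  unfolding compactly_supported_continuous_iff by (auto intro!: exI[of _ "{}"])

lemma compactly_supported_continuous_add:
  fixes f g :: "'a::t2_space \<Rightarrow> real"
  assumes "compactly_supported_continuous f" and "compactly_supported_continuous g"
  shows "compactly_supported_continuous (\<lambda>x. f x + g x)"
proof -
  obtain L L' where "compact L" "compact L'" "\<And>x. x \<notin> L \<Longrightarrow> f x = 0" "\<And>x. x \<notin> L' \<Longrightarrow> g x = 0"
    using assms unfolding compactly_supported_continuous_iff by auto
  then show ?thesis using assms unfolding compactly_supported_continuous_iff
    by (auto intro!: continuous_intros exI[of _ "L \<union> L'"])
qed

lemma compactly_supported_continuous_sum:
  fixes f :: "'b \<Rightarrow> 'a::t2_space \<Rightarrow> real"
  assumes "\<And>i. i \<in> I \<Longrightarrow> compactly_supported_continuous (f i)"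
  shows "compactly_supported_continuous (\<lambda>x. \<Sum>i\<in>I. f i x)"
  using assms
  by (induction I rule: infinite_finite_induct)
     (auto intro: compactly_supported_continuous_zero compactly_supported_continuous_add)

lemma compactly_supported_continuous_bounded:
  fixes f :: "'a::t2_space \<Rightarrow> real"
  assumes "compactly_supported_continuous f"
  shows "\<exists>B>0. \<forall>x. \<bar>f x\<bar> \<le> B"
proof -
  obtain L where L: "compact L" "\<And>x. x \<notin> L \<Longrightarrow> f x = 0" "continuous_on UNIV f"
    using assms unfolding compactly_supported_continuous_iff by blast
  have "compact (f ` L)" using L by (intro compact_continuous_image) (auto intro: continuous_on_subset)
  then obtain B where B: "\<And>x. x \<in> L \<Longrightarrow> \<bar>f x\<bar> \<le> B"
    using compact_imp_bounded[of "f ` L"] unfolding bounded_iff by auto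
  show ?thesis
  proof (intro exI[of _ "\<bar>B\<bar> + 1"] conjI allI)
    show "\<bar>f x\<bar> \<le> \<bar>B\<bar> + 1" for x using L(2)[of x] B[of x] by (cases "x \<in> L") auto
  qed auto
qed

text \<open>
Tietze's extension need not have compact support. Multiplying it by a cutoff function that is one
on \<open>K\<close> changes nothing on \<open>S\<close>, where the extended function vanishes off \<open>K\<close>.
\<close>

lemma compactly_supported_continuous_tietze:
  fixes f :: "'a::{second_countable_topology, t2_space} \<Rightarrow> real"
  assumes lc: "locally_compact_space (euclidean :: 'a topology)"
    and S: "closed S" and f: "continuous_on S f" and K: "compact K" "\<And>x. x \<in> S \<Longrightarrow> x \<notin> K \<Longrightarrow> f x = 0"
  obtains f' where "compactly_supported_continuous f'" "\<And>x. x \<in> S \<Longrightarrow> f' x = f x"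
proof -
  have 1: "closedin euclidean S" "continuous_map (top_of_set S) euclideanreal f"
    using S f by auto
  obtain g where g: "continuous_map euclidean euclideanreal g" "\<And>x. x \<in> S \<Longrightarrow> g x = f x"
    by (rule Tietze_extension_realinterval[OF normal_space_euclidean[OF lc] 1(1), of UNIV f])
       (use 1(2) in auto)
  obtain \<phi> where \<phi>: "compactly_supported_continuous \<phi>" "\<And>x. x \<in> K \<Longrightarrow> \<phi> x = 1"
    using cutoff_function[OF lc K(1)] by metis
  show thesis
  proof (rule that[of "\<lambda>x. g x * \<phi> x"])
    show "compactly_supported_continuous (\<lambda>x. g x * \<phi> x)"
      using g(1) \<phi>(1) by (intro compactly_supported_continuous_mult) auto
    show "g x * \<phi> x = f x" if "x \<in> S" for x
      using g(2)[OF that] K(2)[OF that] \<phi>(2)[of x] by (cases "x \<in> K") auto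
  qed
qed

section \<open>Integration along the fibers\<close>

lemma (in topological_groupoid) nn_integral_translate:
  assumes M: "sets M = sets borel" and f: "f \<in> borel_measurable borel"
  shows "(\<integral>\<^sup>+h. f h \<partial>translate G g M) =
    (\<integral>\<^sup>+h. f (mul G g h) * indicator (fiber G (src G g)) h \<partial>M)"
proof -
  have m: "mul G g \<in> restrict_space M (fiber G (src G g)) \<rightarrow>\<^sub>M borel"
    using mul_measurable[of g] by (simp add: M cong: measurable_cong_sets sets_restrict_space_cong)
  have f': "f \<in> borel_measurable (distr (restrict_space M (fiber G (src G g))) borel (mul G g))"
    using f by simp
  show ?thesis unfolding translate_def
    by (subst nn_integral_distr[OF m f'], subst nn_integral_restrict_space)
       (use fiber_borel[of "src G g"] M in auto)
qed

text \<open>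
On these pairs the left division \<open>(g, h) \<mapsto> inverse g * h\<close> is defined and continuous. All kernels
that are integrated over the fibers are functions on this closed set, extended by zero.
\<close>

definition fibered_pairs :: "('a, 'b) groupoid_ops_scheme \<Rightarrow> ('a \<times> 'a) set" where
  "fibered_pairs G = {(g, h). tgt G g = tgt G h}"

abbreviation ldiv :: "('a, 'b) groupoid_ops_scheme \<Rightarrow> 'a \<Rightarrow> 'a \<Rightarrow> 'a" where
  "ldiv G g h \<equiv> mul G (inversion G g) h"

context topological_groupoid
begin

lemma tgt_units: "x \<in> units G \<Longrightarrow> tgt G x = x" and src_units: "x \<in> units G \<Longrightarrow> src G x = x"
  by (auto simp: units_def)

lemma closed_fibered_pairs: "closed (fibered_pairs G)"
proof -
  have "continuous_on UNIV (\<lambda>p :: 'a \<times> 'a. tgt G (fst p))" "continuous_on UNIV (\<lambda>p :: 'a \<times> 'a. tgt G (snd p))"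
    by (auto intro!: continuous_intros continuous_on_compose2[OF continuous_tgt])
  from closed_Collect_eq[OF this] show ?thesis by (simp add: fibered_pairs_def case_prod_beta')
qed

lemma closed_composable: "closed (composable G)"
proof -
  have "continuous_on UNIV (\<lambda>p :: 'a \<times> 'a. src G (fst p))" "continuous_on UNIV (\<lambda>p :: 'a \<times> 'a. tgt G (snd p))"
    by (auto intro!: continuous_intros continuous_on_compose2[OF continuous_tgt] continuous_on_compose2[OF continuous_src])
  from closed_Collect_eq[OF this] show ?thesis by (simp add: composable_def case_prod_beta')
qed

lemma closed_fiber: "closed (fiber G x)"
proof -
  have "closed (tgt G -` {x})" by (rule closed_vimage[OF closed_singleton continuous_tgt])
  also have "tgt G -` {x} = fiber G x" by (auto simp: fiber_def)
  finally show ?thesis .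
qed

lemma continuous_ldiv: "continuous_on (fibered_pairs G) (\<lambda>(g, h). ldiv G g h)"
proof -
  have "continuous_on (fibered_pairs G) (\<lambda>p. (\<lambda>(g, h). mul G g h) (inversion G (fst p), snd p))"
    by (rule continuous_on_compose2[OF continuous_mul])
       (auto intro!: continuous_intros continuous_on_compose2[OF continuous_inversion]
         simp: composable_def fibered_pairs_def src_inversion)
  then show ?thesis by (simp add: case_prod_beta')
qed

lemma ldiv_mul: "tgt G h = src G g \<Longrightarrow> ldiv G g (mul G g h) = h"
  by (metis inversion_mul mul_assoc src_inversion tgt_mul_left)

lemma mul_ldiv: "tgt G h = tgt G g \<Longrightarrow> mul G g (ldiv G g h) = h"
  by (metis mul_inversion mul_assoc tgt_inversion src_inversion tgt_mul_left)

lemma tgt_ldiv: "tgt G h = tgt G g \<Longrightarrow> tgt G (ldiv G g h) = src G g"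
  by (metis src_inversion tgt_inversion tgt_mul)

text \<open>
Bounds the supports of convolutions and of translates.
\<close>

lemma compact_product_set:
  assumes "compact K" "compact L"
  shows "compact {mul G k l | k l. k \<in> K \<and> l \<in> L \<and> src G k = tgt G l}"
proof -
  have "compact ((K \<times> L) \<inter> composable G)"
    using assms closed_composable by (intro compact_Int_closed compact_Times)
  then have "compact ((\<lambda>(g, h). mul G g h) ` ((K \<times> L) \<inter> composable G))"
    by (rule compact_continuous_image[rotated]) (rule continuous_on_subset[OF continuous_mul], auto)
  also have "(\<lambda>(g, h). mul G g h) ` ((K \<times> L) \<inter> composable G)
    = {mul G k l | k l. k \<in> K \<and> l \<in> L \<and> src G k = tgt G l}"
    by (auto simp: composable_def)
  finally show ?thesis .
qed

lemma fibered_measurable: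
  fixes F :: "'a \<Rightarrow> 'a \<Rightarrow> real"
  assumes "continuous_on (fibered_pairs G) (\<lambda>(g, h). F g h)"
  shows "(\<lambda>(g, h). if tgt G g = tgt G h then F g h else 0) \<in> borel_measurable (borel \<Otimes>\<^sub>M borel)"
proof -
  have "(\<lambda>p. indicator (fibered_pairs G) p *\<^sub>R (\<lambda>(g, h). F g h) p) \<in> borel_measurable borel"
    by (rule borel_measurable_continuous_on_indicator[OF _ assms])
       (rule borel_closed[OF closed_fibered_pairs])
  also have "(\<lambda>p. indicator (fibered_pairs G) p *\<^sub>R (\<lambda>(g, h). F g h) p)
    = (\<lambda>(g, h). if tgt G g = tgt G h then F g h else 0)"
    by (auto simp: fun_eq_iff fibered_pairs_def)
  finally show ?thesis by (simp add: borel_prod)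
qed

lemma fibered_measurable_slice:
  fixes F :: "'a \<Rightarrow> 'a \<Rightarrow> real"
  assumes "continuous_on (fibered_pairs G) (\<lambda>(g, h). F g h)"
  shows "(\<lambda>h. if tgt G g = tgt G h then F g h else 0) \<in> borel_measurable borel"
    and "(\<lambda>h. if tgt G h = tgt G g then F h g else 0) \<in> borel_measurable borel"
  using measurable_Pair2[OF fibered_measurable[OF assms], of g]
    measurable_Pair1[OF fibered_measurable[OF assms], of g] by auto

end

locale haar_groupoid = topological_groupoid G
  for G :: "('a :: {second_countable_topology, t2_space}, 'b) groupoid_ops_scheme" (structure) +
  fixes lam :: "'a \<Rightarrow> 'a measure"
  assumes haar: "haar_system G lam"
begin

lemma radon_lam: "x \<in> units G \<Longrightarrow> radon_measure (lam x)"
  and fiber_lam: "x \<in> units G \<Longrightarrow> measure_on_fiber G x (lam x)"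
  using haar[unfolded haar_system_def, THEN conjunct1, THEN bspec, of x] by (simp_all only:)

lemma lam_translate: "lam (tgt G g) = translate G g (lam (src G g))"
  and continuous_lam: "continuous_system G lam"
  using haar[unfolded haar_system_def, THEN conjunct2] by (simp_all only:)

lemma sets_lam: "x \<in> units G \<Longrightarrow> sets (lam x) = sets borel"
  using radon_lam[unfolded radon_measure_def, THEN conjunct1] .

lemma space_lam: "x \<in> units G \<Longrightarrow> space (lam x) = UNIV"
  using sets_eq_imp_space_eq[OF sets_lam] by simp

lemma AE_lam: "x \<in> units G \<Longrightarrow> AE h in lam x. tgt G h = x"
  using fiber_lam by (simp add: measure_on_fiber_def fiber_def)

lemma measurable_lam: "x \<in> units G \<Longrightarrow> f \<in> borel_measurable borel \<Longrightarrow> f \<in> borel_measurable (lam x)"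
  using sets_lam by (simp cong: measurable_cong_sets)

lemma lam_compact: "x \<in> units G \<Longrightarrow> compact K \<Longrightarrow> emeasure (lam x) K < \<infinity>"
  using radon_lam[unfolded radon_measure_def, THEN conjunct2, THEN conjunct1, rule_format] .

lemma integrable_lam:
  fixes f :: "'a \<Rightarrow> real"
  assumes x: "x \<in> units G" and f: "f \<in> borel_measurable borel"
    and K: "compact K" "\<And>h. h \<notin> K \<Longrightarrow> f h = 0" and B: "\<And>h. \<bar>f h\<bar> \<le> B"
  shows "integrable (lam x) f"
proof (rule Bochner_Integration.integrable_bound)
  have "K \<in> sets (lam x)" using sets_lam[OF x] K(1) by (simp add: borel_compact)
  then show "integrable (lam x) (\<lambda>h. B * indicator K h :: real)"
    using lam_compact[OF x K(1)] by simp
  show "AE h in lam x. norm (f h) \<le> norm (B * indicator K h :: real)"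
  proof (intro AE_I2)
    fix h
    show "norm (f h) \<le> norm (B * indicator K h :: real)"
      using K(2)[of h] order_trans[OF B[of h] abs_ge_self] by (cases "h \<in> K") simp_all
  qed
qed (rule measurable_lam[OF x f])

lemma integrable_csc:
  assumes x: "x \<in> units G" and f: "compactly_supported_continuous f"
  shows "integrable (lam x) f"
proof -
  obtain B where B: "0 < B" "\<And>h. \<bar>f h\<bar> \<le> B"
    using compactly_supported_continuous_bounded[OF f] by auto
  obtain L where L: "compact L" "\<And>h. h \<notin> L \<Longrightarrow> f h = 0" and c: "continuous_on UNIV f"
    using f unfolding compactly_supported_continuous_iff by blast
  show ?thesis
    by (rule integrable_lam[OF x borel_measurable_continuous_onI[OF c] L B(2)])
qed

lemma continuous_integral_tgt:
  assumes "compactly_supported_continuous f"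
  shows "continuous_on UNIV (\<lambda>g. \<integral>h. f h \<partial>lam (tgt G g))"
    and "continuous_on UNIV (\<lambda>g. \<integral>h. f h \<partial>lam (src G g))"
proof -
  have c: "continuous_on (units G) (\<lambda>x. \<integral>h. f h \<partial>lam x)"
    using continuous_lam assms by (simp add: continuous_system_def)
  show "continuous_on UNIV (\<lambda>g. \<integral>h. f h \<partial>lam (tgt G g))"
    by (rule continuous_on_compose2[OF c continuous_tgt]) (auto simp: tgt_unit)
  show "continuous_on UNIV (\<lambda>g. \<integral>h. f h \<partial>lam (src G g))"
    by (rule continuous_on_compose2[OF c continuous_src]) (auto simp: src_unit)
qed

text \<open>
The axiom on Haar systems concerns a fixed integrand. For an integrand \<open>F g\<close> that varies with
\<open>g\<close>, freeze it at \<open>g0\<close>: extend \<open>F g0\<close> from the closed fiber to a compactly supported continuous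
function \<open>f\<close>. By compactness \<open>F g\<close> is uniformly close to \<open>f\<close> on the fiber of \<open>g\<close> when \<open>g\<close> is near
\<open>g0\<close>, and the mass of the supports stays bounded, so the integrals of \<open>F g\<close> and \<open>f\<close> are close.
\<close>

lemma continuous_fiber_integral:
  fixes F :: "'a \<Rightarrow> 'a \<Rightarrow> real"
  assumes F: "continuous_on (fibered_pairs G) (\<lambda>(g, h). F g h)"
    and supp: "\<And>g. \<exists>N K. open N \<and> g \<in> N \<and> compact K \<and> (\<forall>g'\<in>N. \<forall>h. tgt G h = tgt G g' \<longrightarrow> h \<notin> K \<longrightarrow> F g' h = 0)"
  shows "continuous_on UNIV (\<lambda>g. \<integral>h. (if tgt G g = tgt G h then F g h else 0) \<partial>lam (tgt G g))" (is "continuous_on _ ?I")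
    and "integrable (lam (tgt G g)) (\<lambda>h. if tgt G g = tgt G h then F g h else 0)"
proof -
  have slice: "continuous_on (fiber G (tgt G g)) (F g)" for g
  proof -
    have "continuous_on (fiber G (tgt G g)) (\<lambda>h. (\<lambda>(g, h). F g h) (g, h))"
      by (rule continuous_on_compose2[OF F]) (auto intro!: continuous_intros simp: fibered_pairs_def fiber_def)
    then show ?thesis by simp
  qed
  have ext: "\<exists>f. compactly_supported_continuous f \<and> (\<forall>h. tgt G h = tgt G g \<longrightarrow> f h = F g h)" for g
  proof -
    obtain N K where "g \<in> N" and K: "compact K" "\<forall>g'\<in>N. \<forall>h. tgt G h = tgt G g' \<longrightarrow> h \<notin> K \<longrightarrow> F g' h = 0"
      using supp[of g] by metis
    then have z: "F g h = 0" if "h \<in> fiber G (tgt G g)" "h \<notin> K" for h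
      using that by (auto simp: fiber_def)
    obtain f where "compactly_supported_continuous f" "\<And>h. h \<in> fiber G (tgt G g) \<Longrightarrow> f h = F g h"
      using compactly_supported_continuous_tietze[OF locally_compact closed_fiber slice K(1) z] by blast
    then show ?thesis by (auto simp: fiber_def)
  qed
  have int: "integrable (lam (tgt G g)) (\<lambda>h. if tgt G g = tgt G h then F g h else 0)" for g
  proof -
    obtain f where f: "compactly_supported_continuous f" "\<And>h. tgt G h = tgt G g \<Longrightarrow> f h = F g h"
      using ext[of g] by blast
    have "AE h in lam (tgt G g). f h = (if tgt G g = tgt G h then F g h else 0)"
      using AE_lam[OF tgt_unit[of g]] by eventually_elim (simp add: f(2))
    then show ?thesis
      by (intro integrable_cong_AE_imp[OF integrable_csc[OF tgt_unit[of g] f(1)]]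
          measurable_lam tgt_unit fibered_measurable_slice F)
  qed
  then show "integrable (lam (tgt G g)) (\<lambda>h. if tgt G g = tgt G h then F g h else 0)" .
  have "(?I \<longlongrightarrow> ?I g0) (nhds g0)" for g0
  proof (rule tendstoI)
    fix e :: real assume e: "e > 0"
    obtain f where f: "compactly_supported_continuous f" "\<And>h. tgt G h = tgt G g0 \<Longrightarrow> f h = F g0 h"
      using ext[of g0] by blast
    obtain L where L: "compact L" "\<And>x. x \<notin> L \<Longrightarrow> f x = 0" and fc: "continuous_on UNIV f"
      using f(1) unfolding compactly_supported_continuous_iff by blast
    obtain N K where N: "open N" "g0 \<in> N" and K: "compact K"
        "\<And>g h. g \<in> N \<Longrightarrow> tgt G h = tgt G g \<Longrightarrow> h \<notin> K \<Longrightarrow> F g h = 0"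
      using supp[of g0] by metis
    obtain \<phi> where \<phi>: "compactly_supported_continuous \<phi>" "\<And>x. 0 \<le> \<phi> x" "\<And>x. \<phi> x \<le> 1"
        "\<And>x. x \<in> K \<union> L \<Longrightarrow> \<phi> x = 1"
      using cutoff_function[OF locally_compact compact_Un[OF K(1) L(1)]] by metis
    define m where "m = (\<integral>h. \<phi> h \<partial>lam (tgt G g0))"
    have m0: "m \<ge> 0" unfolding m_def using \<phi>(2) by simp
    define d where "d = e / (2 * (m + 1))"
    have d: "d > 0" using e m0 by (simp add: d_def)
    have cont: "continuous_on (fibered_pairs G) (\<lambda>p. \<bar>(\<lambda>(g, h). F g h) p - f (snd p)\<bar>)"
      by (intro continuous_intros F continuous_on_compose2[OF fc]) auto
    obtain T where T: "open T"
      "T \<inter> fibered_pairs G = (\<lambda>p. \<bar>(\<lambda>(g, h). F g h) p - f (snd p)\<bar>) -` {..<d} \<inter> fibered_pairs G"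
      using cont[unfolded continuous_on_open_invariant, rule_format, OF open_lessThan[of d]] by blast
    \<comment> \<open>Pairs outside the closed set \<open>fibered_pairs G\<close> are harmless, so the tube lemma applies.\<close>
    have "open (T \<union> - fibered_pairs G)" using T(1) closed_fibered_pairs by auto
    moreover have "{g0} \<times> (K \<union> L) \<subseteq> T \<union> - fibered_pairs G"
    proof -
      have "(g0, h) \<in> T" if "(g0, h) \<in> fibered_pairs G" for h
      proof -
        have "(g0, h) \<in> T \<inter> fibered_pairs G"
          unfolding T(2) using that d f(2)[of h] by (simp add: fibered_pairs_def)
        then show ?thesis by simp
      qed
      then show ?thesis by auto
    qed
    ultimately obtain X where X: "g0 \<in> X" "open X" "X \<times> (K \<union> L) \<subseteq> T \<union> - fibered_pairs G"
      using Elementary_Topology.tube_lemma[OF compact_Un[OF K(1) L(1)]] by metis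
    \<comment> \<open>Both functions vanish off \<open>K \<union> L\<close>; the factor \<open>\<phi> h\<close> makes the bound integrable.\<close>
    have close: "\<bar>F g h - f h\<bar> \<le> d * \<phi> h" if g: "g \<in> N \<inter> X" and h: "tgt G h = tgt G g" for g h
    proof (cases "h \<in> K \<union> L")
      case True
      then have "(g, h) \<in> T \<inter> fibered_pairs G" using X(3) g h by (auto simp: fibered_pairs_def)
      then have "\<bar>F g h - f h\<bar> < d" unfolding T(2) by simp
      then show ?thesis using \<phi>(4)[OF True] by simp
    next
      case False
      then show ?thesis using K(2)[of g h] L(2)[of h] g h \<phi>(2)[of h] d by simp
    qed
    have near: "\<bar>?I g - (\<integral>h. f h \<partial>lam (tgt G g))\<bar> \<le> d * (\<integral>h. \<phi> h \<partial>lam (tgt G g))" if g: "g \<in> N \<inter> X" for g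
    proof -
      have "?I g - (\<integral>h. f h \<partial>lam (tgt G g)) =
        (\<integral>h. (if tgt G g = tgt G h then F g h else 0) - f h \<partial>lam (tgt G g))"
        using int[of g] integrable_csc[OF tgt_unit[of g] f(1)] by simp
      also have "\<bar>\<dots>\<bar> \<le> (\<integral>h. \<bar>(if tgt G g = tgt G h then F g h else 0) - f h\<bar> \<partial>lam (tgt G g))"
        by (rule integral_abs_bound)
      also have "\<dots> \<le> (\<integral>h. d * \<phi> h \<partial>lam (tgt G g))"
      proof (rule integral_mono_AE)
        show "AE h in lam (tgt G g). \<bar>(if tgt G g = tgt G h then F g h else 0) - f h\<bar> \<le> d * \<phi> h"
          using AE_lam[OF tgt_unit[of g]] by eventually_elim (use close[OF g] in auto)
      qed (use int[of g] integrable_csc[OF tgt_unit[of g]] f(1) \<phi>(1) in auto)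
      also have "\<dots> = d * (\<integral>h. \<phi> h \<partial>lam (tgt G g))" by simp
      finally show ?thesis .
    qed
    have eq: "?I g0 = (\<integral>h. f h \<partial>lam (tgt G g0))"
    proof (rule integral_cong_AE)
      show "AE h in lam (tgt G g0). (if tgt G g0 = tgt G h then F g0 h else 0) = f h"
        using AE_lam[OF tgt_unit[of g0]] by eventually_elim (simp add: f(2))
      show "(\<lambda>h. if tgt G g0 = tgt G h then F g0 h else 0) \<in> borel_measurable (lam (tgt G g0))"
        by (intro measurable_lam tgt_unit fibered_measurable_slice F)
      show "f \<in> borel_measurable (lam (tgt G g0))"
        by (intro measurable_lam tgt_unit borel_measurable_continuous_onI fc)
    qed
    have tend: "((\<lambda>g. \<integral>h. u h \<partial>lam (tgt G g)) \<longlongrightarrow> (\<integral>h. u h \<partial>lam (tgt G g0))) (nhds g0)"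
      if "compactly_supported_continuous u" for u
      using continuous_integral_tgt(1)[OF that] unfolding continuous_on_UNIV_iff_nhds by blast
    have "\<forall>\<^sub>F g in nhds g0. g \<in> N \<inter> X"
      using N X by (intro eventually_nhds_in_open) auto
    moreover have "\<forall>\<^sub>F g in nhds g0. (\<integral>h. \<phi> h \<partial>lam (tgt G g)) < m + 1"
      by (rule order_tendstoD(2)[OF tend[OF \<phi>(1)]]) (simp add: m_def)
    moreover have "\<forall>\<^sub>F g in nhds g0. dist (\<integral>h. f h \<partial>lam (tgt G g)) (\<integral>h. f h \<partial>lam (tgt G g0)) < e / 2"
      by (rule tendstoD[OF tend[OF f(1)]]) (use e in simp)
    ultimately show "\<forall>\<^sub>F g in nhds g0. dist (?I g) (?I g0) < e"
    proof eventually_elim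
      case (elim g)
      have "d * (\<integral>h. \<phi> h \<partial>lam (tgt G g)) \<le> d * (m + 1)" using elim(2) d by (intro mult_left_mono) auto
      also have "\<dots> = e / 2" using m0 by (simp add: d_def field_simps)
      finally have "\<bar>?I g - (\<integral>h. f h \<partial>lam (tgt G g))\<bar> \<le> e / 2" using near[OF elim(1)] by (rule order_trans[rotated])
      moreover have "\<bar>a - c\<bar> < e" if "\<bar>a - b\<bar> \<le> e / 2" "\<bar>b - c\<bar> < e / 2" for a b c :: real
        using that by linarith
      ultimately show ?case using elim(3) unfolding eq dist_real_def by blast
    qed
  qed
  then show "continuous_on UNIV ?I" unfolding continuous_on_UNIV_iff_nhds by blast
qed

end

section \<open>Convolution of compactly supported functions\<close>

context haar_groupoid
begin

lemma measurable_left_translation: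
  fixes f :: "'a \<Rightarrow> ennreal"
  assumes "f \<in> borel_measurable borel"
  shows "(\<lambda>l. f (mul G k l) * indicator (fiber G (src G k)) l) \<in> borel_measurable borel"
  using measurable_compose[OF mul_measurable assms, of k] fiber_borel[of "src G k"]
  by (subst borel_measurable_restrict_space_iff_ennreal[symmetric]) auto

lemma integral_nn_csc:
  assumes "x \<in> units G" "compactly_supported_continuous q" "\<And>h. 0 \<le> q h"
  shows "(\<integral>\<^sup>+h. ennreal (q h) \<partial>lam x) = ennreal (\<integral>h. q h \<partial>lam x)"
  using assms by (intro nn_integral_eq_integral integrable_csc) auto

text \<open>
The density of the law of \<open>k * l\<close> when \<open>k\<close> has density \<open>q\<close> and, given \<open>k\<close>, the factor \<open>l\<close> has
density \<open>r\<close> on the fiber over \<open>src k\<close>.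
\<close>

definition convolution :: "('a \<Rightarrow> real) \<Rightarrow> ('a \<Rightarrow> real) \<Rightarrow> 'a \<Rightarrow> real" where
  "convolution q r h =
     (\<integral>k. (if tgt G h = tgt G k then q k * r (ldiv G k h) else 0) \<partial>lam (tgt G h))"

context
  fixes q r :: "'a \<Rightarrow> real"
  assumes q: "compactly_supported_continuous q" and r: "compactly_supported_continuous r"
    and q_nonneg: "\<And>h. 0 \<le> q h" and r_nonneg: "\<And>h. 0 \<le> r h"
begin

lemma continuous_convolution_integrand:
  "continuous_on (fibered_pairs G) (\<lambda>(h, k). q k * r (ldiv G k h))"
proof -
  have qc: "continuous_on UNIV q" and rc: "continuous_on UNIV r"
    using q r by (auto simp: compactly_supported_continuous_def)
  have l: "continuous_on (fibered_pairs G) (\<lambda>p. (\<lambda>(g, h). ldiv G g h) (snd p, fst p))"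
    by (rule continuous_on_compose2[OF continuous_ldiv])
       (auto intro!: continuous_intros simp: fibered_pairs_def)
  have "continuous_on (fibered_pairs G) (\<lambda>p. q (snd p) * r (ldiv G (snd p) (fst p)))"
    by (intro continuous_intros continuous_on_compose2[OF qc] continuous_on_compose2[OF rc])
       (use l in auto)
  then show ?thesis by (simp add: case_prod_beta')
qed

lemma convolution_integrand_support:
  "\<exists>N K. open N \<and> g \<in> N \<and> compact K \<and>
     (\<forall>g'\<in>N. \<forall>h. tgt G h = tgt G g' \<longrightarrow> h \<notin> K \<longrightarrow> q h * r (ldiv G h g') = 0)"
proof -
  obtain K where K: "compact K" "\<And>x. x \<notin> K \<Longrightarrow> q x = 0"
    using q unfolding compactly_supported_continuous_iff by blast
  show ?thesis by (intro exI[of _ UNIV] exI[of _ K]) (use K in auto)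
qed

lemma convolution_nonneg: "0 \<le> convolution q r h"
  unfolding convolution_def using q_nonneg r_nonneg by (intro integral_nonneg_AE AE_I2) auto

lemma compactly_supported_continuous_convolution:
  "compactly_supported_continuous (convolution q r)"
  unfolding compactly_supported_continuous_iff
proof (intro conjI)
  show "continuous_on UNIV (convolution q r)"
    unfolding convolution_def
    by (rule continuous_fiber_integral(1)[OF continuous_convolution_integrand convolution_integrand_support])
  obtain K where K: "compact K" "\<And>x. x \<notin> K \<Longrightarrow> q x = 0"
    using q unfolding compactly_supported_continuous_iff by blast
  obtain L where L: "compact L" "\<And>x. x \<notin> L \<Longrightarrow> r x = 0"
    using r unfolding compactly_supported_continuous_iff by blast
  let ?KL = "{mul G k l | k l. k \<in> K \<and> l \<in> L \<and> src G k = tgt G l}"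
  have "convolution q r h = 0" if "h \<notin> ?KL" for h
  proof -
    have "q k * r (ldiv G k h) = 0" if t: "tgt G h = tgt G k" for k
    proof (rule ccontr)
      assume "q k * r (ldiv G k h) \<noteq> 0"
      then have "k \<in> K" "ldiv G k h \<in> L" using K(2)[of k] L(2)[of "ldiv G k h"] by auto
      then have "mul G k (ldiv G k h) \<in> ?KL" using tgt_ldiv[OF t] by force
      with \<open>h \<notin> ?KL\<close> show False unfolding mul_ldiv[OF t] by (rule notE)
    qed
    then have "(\<lambda>k. if tgt G h = tgt G k then q k * r (ldiv G k h) else 0) = (\<lambda>k. 0)" by auto
    then show ?thesis by (simp add: convolution_def)
  qed
  then show "\<exists>L. compact L \<and> (\<forall>x. x \<notin> L \<longrightarrow> convolution q r x = 0)"
    using compact_product_set[OF K(1) L(1)] by (intro exI[of _ ?KL]) blast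
qed

text \<open>
Fubini's theorem on the fiber over \<open>x\<close>, followed by the substitution \<open>h = k * l\<close> in the inner
integral, which is the invariance of the Haar system.
\<close>

lemma nn_integral_convolution:
  fixes f :: "'a \<Rightarrow> ennreal"
  assumes x: "x \<in> units G" and f[measurable]: "f \<in> borel_measurable borel"
  shows "(\<integral>\<^sup>+h. ennreal (convolution q r h) * f h \<partial>lam x) =
    (\<integral>\<^sup>+k. ennreal (q k) *
       (\<integral>\<^sup>+l. ennreal (r l) * (f (mul G k l) * indicator (fiber G (src G k)) l) \<partial>lam (src G k)) \<partial>lam x)"
proof -
  define K where "K h k = (if tgt G h = tgt G k then q k * r (ldiv G k h) else 0)" for h k
  have K0: "0 \<le> K h k" for h k using q_nonneg r_nonneg by (simp add: K_def)
  have Km[measurable]: "case_prod K \<in> borel_measurable (borel \<Otimes>\<^sub>M borel)"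
    using fibered_measurable[OF continuous_convolution_integrand] by (simp add: K_def case_prod_beta')
  note sets_lam[OF x, measurable_cong]
  interpret L: sigma_finite_measure "lam x" by (rule sigma_finite_haar[OF haar x])
  interpret pair_sigma_finite "lam x" "lam x" ..
  have rm[measurable]: "r \<in> borel_measurable borel"
    using r by (auto simp: compactly_supported_continuous_def intro: borel_measurable_continuous_onI)
  have "(\<integral>\<^sup>+h. ennreal (convolution q r h) * f h \<partial>lam x)
      = (\<integral>\<^sup>+h. (\<integral>\<^sup>+k. ennreal (K h k) * f h \<partial>lam x) \<partial>lam x)"
  proof (rule nn_integral_cong_AE)
    show "AE h in lam x. ennreal (convolution q r h) * f h = (\<integral>\<^sup>+k. ennreal (K h k) * f h \<partial>lam x)"
      using AE_lam[OF x]
    proof eventually_elim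
      case (elim h)
      have "integrable (lam (tgt G h)) (K h)"
        unfolding K_def
        by (rule continuous_fiber_integral(2)[OF continuous_convolution_integrand convolution_integrand_support])
      then have "ennreal (convolution q r h) = (\<integral>\<^sup>+k. ennreal (K h k) \<partial>lam x)"
      proof (subst nn_integral_eq_integral)
        show "integrable (lam x) (K h)" using \<open>integrable (lam (tgt G h)) (K h)\<close> elim by simp
        show "ennreal (convolution q r h) = ennreal (\<integral>k. K h k \<partial>lam x)"
          using elim by (simp add: convolution_def K_def)
      qed (simp add: K0)
      then show ?case by (simp add: nn_integral_multc)
    qed
  qed
  also have "\<dots> = (\<integral>\<^sup>+k. (\<integral>\<^sup>+h. ennreal (K h k) * f h \<partial>lam x) \<partial>lam x)"
    by (rule Fubini') measurable
  also have "\<dots> = (\<integral>\<^sup>+k. ennreal (q k) *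
       (\<integral>\<^sup>+l. ennreal (r l) * (f (mul G k l) * indicator (fiber G (src G k)) l) \<partial>lam (src G k)) \<partial>lam x)"
  proof (rule nn_integral_cong_AE)
    show "AE k in lam x. (\<integral>\<^sup>+h. ennreal (K h k) * f h \<partial>lam x) = ennreal (q k) *
       (\<integral>\<^sup>+l. ennreal (r l) * (f (mul G k l) * indicator (fiber G (src G k)) l) \<partial>lam (src G k))"
      using AE_lam[OF x]
    proof eventually_elim
      case (elim k)
      have "(\<integral>\<^sup>+h. ennreal (K h k) * f h \<partial>lam x) = (\<integral>\<^sup>+h. ennreal (K h k) * f h \<partial>translate G k (lam (src G k)))"
        using lam_translate[of k] elim by simp
      also have "\<dots> = (\<integral>\<^sup>+l. ennreal (K (mul G k l) k) * f (mul G k l) * indicator (fiber G (src G k)) l \<partial>lam (src G k))"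
        by (rule nn_integral_translate) (use sets_lam[OF src_unit] in simp, measurable)
      also have "\<dots> = (\<integral>\<^sup>+l. ennreal (q k) * (ennreal (r l) * (f (mul G k l) * indicator (fiber G (src G k)) l)) \<partial>lam (src G k))"
        by (intro nn_integral_cong)
           (auto simp: indicator_def K_def fiber_def tgt_mul ldiv_mul ennreal_mult q_nonneg r_nonneg mult.assoc)
      also have "\<dots> = ennreal (q k) *
        (\<integral>\<^sup>+l. ennreal (r l) * (f (mul G k l) * indicator (fiber G (src G k)) l) \<partial>lam (src G k))"
        using measurable_left_translation[OF f, of k] rm sets_lam[OF src_unit[of k]]
        by (intro nn_integral_cmult) (simp cong: measurable_cong_sets)
      finally show ?case .
    qed
  qed
  finally show ?thesis .
qed

end

end

section \<open>Compactly supported minorants of the transition densities\<close>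

locale invariant_markov_operator = haar_groupoid G lam
  for G :: "('a :: {second_countable_topology, t2_space}, 'b) groupoid_ops_scheme" (structure)
    and lam :: "'a \<Rightarrow> 'a measure" +
  fixes \<pi> :: "'a \<Rightarrow> 'a measure"
  assumes invariant: "invariant_markov_kernel G \<pi>"
    and densities: "continuous_densities G lam \<pi>"
begin

lemma kernel: "\<pi> \<in> borel \<rightarrow>\<^sub>M prob_algebra borel"
  using invariant by (simp add: invariant_markov_kernel_def markov_kernel_def)

lemma kernel_subprob[measurable]: "\<pi> \<in> borel \<rightarrow>\<^sub>M subprob_algebra borel"
  by (rule measurable_prob_algebraD[OF kernel])

lemma prob_kernel: "prob_space (\<pi> h)" and sets_kernel[simp, measurable_cong]: "sets (\<pi> h) = sets borel"
  using measurable_space[OF kernel, of h] by (auto simp: space_prob_algebra)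

lemma space_kernel[simp]: "space (\<pi> h) = UNIV"
  using sets_eq_imp_space_eq[OF sets_kernel] by simp

lemma AE_kernel: "AE k in \<pi> h. tgt G k = tgt G h"
  using invariant by (auto simp: invariant_markov_kernel_def measure_on_fiber_def fiber_def)

lemma kernel_translate: "src G g = tgt G h \<Longrightarrow> \<pi> (mul G g h) = translate G g (\<pi> h)"
  using invariant by (auto simp: invariant_markov_kernel_def composable_def)

text \<open>
The law of the Markov chain after \<open>n + 1\<close> steps. At time zero the law is a point mass, which
in general has no density, so the count starts with one step.
\<close>

primrec step :: "nat \<Rightarrow> 'a \<Rightarrow> 'a measure" where
  "step 0 = \<pi>"
| "step (Suc n) = (\<lambda>h. step n h \<bind> \<pi>)"

lemma step_measurable: "step n \<in> borel \<rightarrow>\<^sub>M prob_algebra borel"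
proof (induction n)
  case 0
  show ?case using kernel by simp
next
  case (Suc n)
  show ?case unfolding step.simps
    by (rule measurable_bind_prob_space[OF Suc kernel])
qed

lemma prob_step: "prob_space (step n h)" and sets_step[simp, measurable_cong]: "sets (step n h) = sets borel"
  using measurable_space[OF step_measurable, of h n] by (auto simp: space_prob_algebra)

lemma nn_integral_step_Suc:
  "f \<in> borel_measurable borel \<Longrightarrow> (\<integral>\<^sup>+k. f k \<partial>step (Suc n) h) = (\<integral>\<^sup>+k. (\<integral>\<^sup>+l. f l \<partial>\<pi> k) \<partial>step n h)"
  unfolding step.simps by (rule nn_integral_bind[where B = borel]) simp_all

text \<open>
For positive \<open>n\<close> the density of \<open>step n x\<close> may fail to be continuous, since convolving unbounded
functions without compact support need not preserve continuity. Instead, \<open>q\<close> is a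
continuous compactly supported minorant of that density, tested against nonnegative functions.
\<close>

definition subdensity :: "nat \<Rightarrow> ('a \<Rightarrow> real) \<Rightarrow> bool" where
  "subdensity n q \<longleftrightarrow> compactly_supported_continuous q \<and> (\<forall>h. 0 \<le> q h) \<and>
     (\<forall>x\<in>units G. \<forall>f\<in>borel_measurable borel.
        (\<integral>\<^sup>+h. ennreal (q h) * f h \<partial>lam x) \<le> (\<integral>\<^sup>+h. f h \<partial>step n x))"

text \<open>
At one unit, a cutoff of the density \<open>p\<close> keeps almost all of the mass because \<open>\<pi> x\<close> is almost
carried by a compact set. By continuity of the Haar system the same cutoff works at nearby units,
so finitely many cutoffs suffice on \<open>C\<close>, and one cutoff function dominates them all.
\<close>

lemma exists_one_step_subdensity:
  assumes C: "compact C" "C \<subseteq> units G" and e: "e > 0"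
  shows "\<exists>q. subdensity 0 q \<and> (\<forall>x\<in>C. 1 - e < (\<integral>h. q h \<partial>lam x))"
proof -
  obtain p where p: "continuous_on UNIV p" "\<And>g. 0 \<le> p g"
      "\<And>x. x \<in> units G \<Longrightarrow> \<pi> x = density (lam x) (\<lambda>g. ennreal (p g))"
    using densities unfolding continuous_densities_def by blast
  have pm[measurable]: "p \<in> borel_measurable borel" by (rule borel_measurable_continuous_onI[OF p(1)])
  have csc: "compactly_supported_continuous (\<lambda>h. p h * \<phi> h)" if "compactly_supported_continuous \<phi>" for \<phi>
    using p(1) that by (rule compactly_supported_continuous_mult)
  obtain K :: "nat \<Rightarrow> 'a set" where K: "\<And>n. compact (K n)" "incseq K" "(\<Union>n. K n) = UNIV"
    using compact_exhaustion[OF locally_compact] by blast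
  have "\<exists>\<phi>. compactly_supported_continuous \<phi> \<and> (\<forall>h. 0 \<le> \<phi> h \<and> \<phi> h \<le> 1) \<and>
     1 - e < (\<integral>h. p h * \<phi> h \<partial>lam x)" if x: "x \<in> units G" for x
  proof -
    interpret prob_space "\<pi> x" by (rule prob_kernel)
    have "(\<lambda>n. measure (\<pi> x) (K n)) \<longlonglongrightarrow> measure (\<pi> x) (\<Union>n. K n)"
      by (rule finite_Lim_measure_incseq) (use K borel_compact in auto)
    moreover have "measure (\<pi> x) (\<Union>n. K n) = 1" using prob_space K(3) by simp
    ultimately have "\<forall>\<^sub>F n in sequentially. 1 - e < measure (\<pi> x) (K n)"
      using e by (intro order_tendstoD(1)) auto
    then obtain n where n: "1 - e < measure (\<pi> x) (K n)"
      by (auto simp: eventually_sequentially)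
    obtain \<phi> where \<phi>: "compactly_supported_continuous \<phi>" "\<And>x. 0 \<le> \<phi> x" "\<And>x. \<phi> x \<le> 1"
        "\<And>x. x \<in> K n \<Longrightarrow> \<phi> x = 1"
      using cutoff_function[OF locally_compact K(1), of n] by metis
    have \<phi>m[measurable]: "\<phi> \<in> borel_measurable borel"
      using \<phi>(1) by (auto simp: compactly_supported_continuous_def intro: borel_measurable_continuous_onI)
    have "measure (\<pi> x) (K n) = (\<integral>h. indicator (K n) h \<partial>\<pi> x)" by simp
    also have "\<dots> \<le> (\<integral>h. \<phi> h \<partial>\<pi> x)"
    proof (rule integral_mono)
      show "integrable (\<pi> x) (indicat_real (K n))"
        by (rule integrable_const_bound[of _ 1]) (use borel_compact[OF K(1)] in auto)
      show "integrable (\<pi> x) \<phi>"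
        by (rule integrable_const_bound[of _ 1]) (use \<phi> in auto)
      show "indicat_real (K n) h \<le> \<phi> h" for h using \<phi>(2,4) by (simp add: indicator_def)
    qed
    also have "\<dots> = (\<integral>h. p h * \<phi> h \<partial>lam x)"
      unfolding p(3)[OF x] using p(2) measurable_lam[OF x pm] measurable_lam[OF x \<phi>m]
      by (subst integral_density) auto
    finally show ?thesis using n \<phi> by (intro exI[of _ \<phi>]) auto
  qed
  then obtain \<phi> where \<phi>: "\<And>x. x \<in> units G \<Longrightarrow> compactly_supported_continuous (\<phi> x)"
      "\<And>x h. x \<in> units G \<Longrightarrow> 0 \<le> \<phi> x h" "\<And>x h. x \<in> units G \<Longrightarrow> \<phi> x h \<le> 1"
      "\<And>x. x \<in> units G \<Longrightarrow> 1 - e < (\<integral>h. p h * \<phi> x h \<partial>lam x)"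
    by metis
  define W where "W x = {g. 1 - e < (\<integral>h. p h * \<phi> x h \<partial>lam (tgt G g))}" for x
  have W_open: "open (W x)" if "x \<in> C" for x
    unfolding W_def using continuous_integral_tgt(1)[OF csc[OF \<phi>(1)], of x] that C(2)
    by (intro open_Collect_less continuous_intros) auto
  have W_in: "x \<in> W x" if "x \<in> C" for x
    using that C(2) \<phi>(4)[of x] tgt_units[of x] by (auto simp: W_def)
  obtain D where D: "D \<subseteq> C" "finite D" "C \<subseteq> (\<Union>x\<in>D. W x)"
    by (rule compactE_image[OF C(1), of C W]) (use W_open W_in in auto)
  have "\<forall>x\<in>D. \<exists>L. compact L \<and> (\<forall>h. h \<notin> L \<longrightarrow> \<phi> x h = 0)"
    using \<phi>(1) D(1) C(2) unfolding compactly_supported_continuous_iff by blast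
  from bchoice[OF this] obtain L where L: "\<And>x. x \<in> D \<Longrightarrow> compact (L x)"
      "\<And>x h. x \<in> D \<Longrightarrow> h \<notin> L x \<Longrightarrow> \<phi> x h = 0" by blast
  obtain \<psi> where \<psi>: "compactly_supported_continuous \<psi>" "\<And>x. 0 \<le> \<psi> x" "\<And>x. \<psi> x \<le> 1"
      "\<And>x. x \<in> (\<Union>y\<in>D. L y) \<Longrightarrow> \<psi> x = 1"
    by (rule cutoff_function[OF locally_compact, of "\<Union>y\<in>D. L y"]) (use D(2) L(1) in \<open>auto intro!: compact_UN\<close>)
  show ?thesis
  proof (intro exI[of _ "\<lambda>h. p h * \<psi> h"] conjI ballI)
    show "subdensity 0 (\<lambda>h. p h * \<psi> h)"
      unfolding subdensity_def
    proof (intro conjI allI ballI csc \<psi>(1))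
      show "0 \<le> p h * \<psi> h" for h using p(2) \<psi>(2) by simp
      fix x and f :: "'a \<Rightarrow> ennreal" assume x: "x \<in> units G" and f: "f \<in> borel_measurable borel"
      have "(\<integral>\<^sup>+h. ennreal (p h * \<psi> h) * f h \<partial>lam x) \<le> (\<integral>\<^sup>+h. ennreal (p h) * f h \<partial>lam x)"
        by (intro nn_integral_mono mult_right_mono ennreal_leI)
           (use p(2) \<psi>(3) in \<open>auto intro: mult_left_le\<close>)
      also have "\<dots> = (\<integral>\<^sup>+h. f h \<partial>step 0 x)"
        unfolding step.simps p(3)[OF x] using measurable_lam[OF x pm] measurable_lam[OF x f]
        by (subst nn_integral_density) auto
      finally show "(\<integral>\<^sup>+h. ennreal (p h * \<psi> h) * f h \<partial>lam x) \<le> (\<integral>\<^sup>+h. f h \<partial>step 0 x)" .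
    qed
    fix x assume x: "x \<in> C"
    then obtain y where y: "y \<in> D" "x \<in> W y" using D(3) by blast
    have yu: "y \<in> units G" and xu: "x \<in> units G" using y D(1) C(2) x by auto
    have "1 - e < (\<integral>h. p h * \<phi> y h \<partial>lam x)" using y(2) tgt_units[OF xu] by (simp add: W_def)
    also have "\<dots> \<le> (\<integral>h. p h * \<psi> h \<partial>lam x)"
    proof (rule integral_mono)
      show "p h * \<phi> y h \<le> p h * \<psi> h" for h
      proof (cases "h \<in> L y")
        case True
        then have "\<psi> h = 1" using \<psi>(4) y(1) by blast
        then show ?thesis using \<phi>(3)[OF yu, of h] p(2)[of h] by (simp add: mult_left_le)
      next
        case False
        then show ?thesis using L(2)[OF y(1) False] \<psi>(2)[of h] p(2)[of h] by simp
      qed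
    qed (use integrable_csc[OF xu csc] \<phi>(1)[OF yu] \<psi>(1) in auto)
    finally show "1 - e < (\<integral>h. p h * \<psi> h \<partial>lam x)" .
  qed
qed

text \<open>
Convolve a minorant \<open>q\<close> for \<open>n\<close> with a minorant \<open>r\<close> for one step. To keep the mass on \<open>C\<close> it is
enough that \<open>r\<close> has almost full mass at the sources of the points in the support of \<open>q\<close>, and
these form a compact set of units.
\<close>

lemma exists_subdensity:
  assumes "compact C" "C \<subseteq> units G" and "e > 0"
  shows "\<exists>q. subdensity n q \<and> (\<forall>x\<in>C. 1 - e < (\<integral>h. q h \<partial>lam x))"
  using assms
proof (induction n arbitrary: e)
  case 0
  then show ?case by (rule exists_one_step_subdensity)
next
  case (Suc n)
  \<comment> \<open>Each factor loses at most \<open>d\<close>, and \<open>(1 - d) * (1 - d) > 1 - 2 * d\<close>.\<close>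
  define d where "d = min (e / 2) (1 / 2)"
  have d: "d > 0" "d \<le> 1 / 2" "2 * d \<le> e" using Suc.prems by (auto simp: d_def)
  obtain q where q: "subdensity n q" "\<And>x. x \<in> C \<Longrightarrow> 1 - d < (\<integral>h. q h \<partial>lam x)"
    using Suc.IH[OF Suc.prems(1,2) d(1)] by blast
  have qc: "compactly_supported_continuous q" and q0: "\<And>h. 0 \<le> q h"
    and q_le: "\<And>x f. x \<in> units G \<Longrightarrow> f \<in> borel_measurable borel \<Longrightarrow>
      (\<integral>\<^sup>+h. ennreal (q h) * f h \<partial>lam x) \<le> (\<integral>\<^sup>+h. f h \<partial>step n x)"
    using q(1) unfolding subdensity_def by auto
  obtain L where L: "compact L" "\<And>h. h \<notin> L \<Longrightarrow> q h = 0"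
    using qc unfolding compactly_supported_continuous_iff by blast
  have "compact (src G ` L)"
    by (rule compact_continuous_image[OF continuous_on_subset[OF continuous_src] L(1)]) simp
  moreover have "src G ` L \<subseteq> units G" using src_unit by auto
  ultimately obtain r where r: "subdensity 0 r" "\<And>x. x \<in> src G ` L \<Longrightarrow> 1 - d < (\<integral>h. r h \<partial>lam x)"
    using exists_one_step_subdensity[of "src G ` L" d] d(1) by blast
  have rc: "compactly_supported_continuous r" and r0: "\<And>h. 0 \<le> r h"
    and r_le: "\<And>x f. x \<in> units G \<Longrightarrow> f \<in> borel_measurable borel \<Longrightarrow>
      (\<integral>\<^sup>+h. ennreal (r h) * f h \<partial>lam x) \<le> (\<integral>\<^sup>+h. f h \<partial>\<pi> x)"
    using r(1) unfolding subdensity_def by auto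
  have cc: "compactly_supported_continuous (convolution q r)"
    by (rule compactly_supported_continuous_convolution[OF qc rc q0 r0])
  have c0: "0 \<le> convolution q r h" for h by (rule convolution_nonneg[OF qc rc q0 r0])
  show ?case
  proof (intro exI[of _ "convolution q r"] conjI ballI)
    show "subdensity (Suc n) (convolution q r)"
      unfolding subdensity_def
    proof (intro conjI allI ballI cc c0)
      fix x and f :: "'a \<Rightarrow> ennreal" assume x: "x \<in> units G" and f[measurable]: "f \<in> borel_measurable borel"
      have "(\<integral>\<^sup>+h. ennreal (convolution q r h) * f h \<partial>lam x) = (\<integral>\<^sup>+k. ennreal (q k) *
         (\<integral>\<^sup>+l. ennreal (r l) * (f (mul G k l) * indicator (fiber G (src G k)) l) \<partial>lam (src G k)) \<partial>lam x)"
        by (rule nn_integral_convolution[OF qc rc q0 r0 x f])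
      also have "\<dots> \<le> (\<integral>\<^sup>+k. ennreal (q k) * (\<integral>\<^sup>+l. f l \<partial>\<pi> k) \<partial>lam x)"
      proof (intro nn_integral_mono mult_left_mono)
        fix k
        have "(\<integral>\<^sup>+l. ennreal (r l) * (f (mul G k l) * indicator (fiber G (src G k)) l) \<partial>lam (src G k))
          \<le> (\<integral>\<^sup>+l. f (mul G k l) * indicator (fiber G (src G k)) l \<partial>\<pi> (src G k))"
          by (rule r_le[OF src_unit measurable_left_translation[OF f]])
        also have "\<dots> = (\<integral>\<^sup>+l. f l \<partial>translate G k (\<pi> (src G k)))"
          by (rule nn_integral_translate[OF sets_kernel f, symmetric])
        also have "translate G k (\<pi> (src G k)) = \<pi> k"
          using kernel_translate[of k "src G k"] tgt_units[OF src_unit[of k]] by (simp add: mul_src)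
        finally show "(\<integral>\<^sup>+l. ennreal (r l) * (f (mul G k l) * indicator (fiber G (src G k)) l) \<partial>lam (src G k))
          \<le> (\<integral>\<^sup>+l. f l \<partial>\<pi> k)" .
      qed auto
      also have "\<dots> \<le> (\<integral>\<^sup>+k. (\<integral>\<^sup>+l. f l \<partial>\<pi> k) \<partial>step n x)"
        by (rule q_le[OF x]) measurable
      also have "\<dots> = (\<integral>\<^sup>+k. f k \<partial>step (Suc n) x)" by (rule nn_integral_step_Suc[OF f, symmetric])
      finally show "(\<integral>\<^sup>+h. ennreal (convolution q r h) * f h \<partial>lam x) \<le> (\<integral>\<^sup>+h. f h \<partial>step (Suc n) x)" .
    qed
    fix x assume xC: "x \<in> C"
    then have x: "x \<in> units G" using Suc.prems by blast
    have "ennreal ((1 - d) * (1 - d)) \<le> ennreal ((1 - d) * (\<integral>k. q k \<partial>lam x))"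
      using q(2)[OF xC] d by (intro ennreal_leI mult_left_mono) auto
    also have "\<dots> = (\<integral>\<^sup>+k. ennreal (1 - d) * ennreal (q k) \<partial>lam x)"
      using d integral_nn_csc[OF x qc q0] measurable_lam[OF x] qc integrable_csc[OF x qc]
      by (subst nn_integral_cmult) (auto simp: ennreal_mult' )
    also have "\<dots> \<le> (\<integral>\<^sup>+k. ennreal (q k) *
         (\<integral>\<^sup>+l. ennreal (r l) * (1 * indicator (fiber G (src G k)) l) \<partial>lam (src G k)) \<partial>lam x)"
    proof (intro nn_integral_mono)
      fix k
      have "(\<integral>\<^sup>+l. ennreal (r l) * (1 * indicator (fiber G (src G k)) l) \<partial>lam (src G k)) = (\<integral>\<^sup>+l. ennreal (r l) \<partial>lam (src G k))"
        by (rule nn_integral_cong_AE)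
           (use AE_lam[OF src_unit[of k]] in \<open>eventually_elim, auto simp: fiber_def\<close>)
      then have *: "(\<integral>\<^sup>+l. ennreal (r l) * (1 * indicator (fiber G (src G k)) l) \<partial>lam (src G k)) = ennreal (\<integral>l. r l \<partial>lam (src G k))"
        by (simp add: integral_nn_csc[OF src_unit rc r0])
      show "ennreal (1 - d) * ennreal (q k) \<le> ennreal (q k) *
         (\<integral>\<^sup>+l. ennreal (r l) * (1 * indicator (fiber G (src G k)) l) \<partial>lam (src G k))"
      proof (cases "k \<in> L")
        case True
        then have "ennreal (1 - d) \<le> ennreal (\<integral>l. r l \<partial>lam (src G k))"
          using r(2)[of "src G k"] by (intro ennreal_leI) auto
        then show ?thesis unfolding * by (subst mult.commute) (rule mult_left_mono, auto)
      qed (simp add: L(2))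
    qed
    also have "\<dots> = (\<integral>\<^sup>+h. ennreal (convolution q r h) * 1 \<partial>lam x)"
      by (rule nn_integral_convolution[OF qc rc q0 r0 x, symmetric]) simp
    also have "\<dots> = ennreal (\<integral>h. convolution q r h \<partial>lam x)"
      using integral_nn_csc[OF x cc c0] by simp
    finally have "(1 - d) * (1 - d) \<le> (\<integral>h. convolution q r h \<partial>lam x)"
      using c0 by (subst (asm) ennreal_le_iff) auto
    moreover have "1 - e < (1 - d) * (1 - d)"
    proof -
      have "(1 - d) * (1 - d) = 1 - 2 * d + d * d" by (simp add: algebra_simps)
      moreover have "0 < d * d" using d(1) by simp
      ultimately show ?thesis using d(3) by argo
    qed
    ultimately show "1 - e < (\<integral>h. convolution q r h \<partial>lam x)" by (rule less_le_trans[rotated])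
  qed
qed

end

section \<open>Averages of the operator and harmonic functions\<close>

definition unit_valued :: "('a::topological_space \<Rightarrow> real) set" where
  "unit_valued = {f \<in> borel_measurable borel. \<forall>h. 0 \<le> f h \<and> f h \<le> 1}"

lemma unit_valuedD:
  assumes "f \<in> unit_valued"
  shows "f \<in> borel_measurable borel" "0 \<le> f h" "f h \<le> 1"
  using assms by (auto simp: unit_valued_def)

lemma unit_valuedI:
  "f \<in> borel_measurable borel \<Longrightarrow> (\<And>h. 0 \<le> f h) \<Longrightarrow> (\<And>h. f h \<le> 1) \<Longrightarrow> f \<in> unit_valued"
  by (auto simp: unit_valued_def)

lemma unit_valued_midpoint:
  "f \<in> unit_valued \<Longrightarrow> g \<in> unit_valued \<Longrightarrow> (\<lambda>h. (f h + g h) / 2) \<in> unit_valued"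
proof (rule unit_valuedI)
  assume f: "f \<in> unit_valued" and g: "g \<in> unit_valued"
  note [measurable] = unit_valuedD(1)[OF f] unit_valuedD(1)[OF g]
  show "(\<lambda>h. (f h + g h) / 2) \<in> borel_measurable borel" by measurable
  show "0 \<le> (f h + g h) / 2" "(f h + g h) / 2 \<le> 1" for h
    using unit_valuedD(2,3)[OF f, of h] unit_valuedD(2,3)[OF g, of h] by auto
qed

lemma unit_valued_complement: "f \<in> unit_valued \<Longrightarrow> (\<lambda>h. 1 - f h) \<in> unit_valued"
  by (rule unit_valuedI) (auto dest: unit_valuedD)

lemma integrable_unit_valued:
  assumes "finite_measure M" "sets M = sets borel" "f \<in> unit_valued"
  shows "integrable M f"
proof -
  interpret finite_measure M by fact
  have "f \<in> borel_measurable M" using unit_valuedD(1)[OF assms(3)] assms(2) by (simp cong: measurable_cong_sets)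
  then show ?thesis by (rule integrable_const_bound[of _ 1, rotated]) (simp add: unit_valuedD[OF assms(3)])
qed

lemma nn_integral_unit_valued:
  assumes "finite_measure M" "sets M = sets borel" "f \<in> unit_valued"
  shows "(\<integral>\<^sup>+h. ennreal (f h) \<partial>M) = ennreal (\<integral>h. f h \<partial>M)"
  using integrable_unit_valued[OF assms] unit_valuedD[OF assms(3)] by (intro nn_integral_eq_integral) auto

context invariant_markov_operator
begin

abbreviation "P \<equiv> markov_op \<pi>"

lemma integrable_kernel: "f \<in> unit_valued \<Longrightarrow> integrable (\<pi> h) f"
  using prob_kernel[of h] by (intro integrable_unit_valued) (auto simp: prob_space_def)

lemma P_unit_valued:
  assumes "f \<in> unit_valued" shows "P f \<in> unit_valued"
proof (rule unit_valuedI)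
  show "P f \<in> borel_measurable borel"
    unfolding markov_op_def
    by (rule measurable_compose[OF kernel_subprob integral_measurable_subprob_algebra[OF unit_valuedD(1)[OF assms]]])
  fix h
  interpret prob_space "\<pi> h" by (rule prob_kernel)
  show "0 \<le> P f h" unfolding markov_op_def using unit_valuedD[OF assms] by simp
  have "(\<integral>k. f k \<partial>\<pi> h) \<le> (\<integral>k. 1 \<partial>\<pi> h)"
    by (rule integral_mono) (use integrable_kernel[OF assms] unit_valuedD[OF assms] in auto)
  then show "P f h \<le> 1" unfolding markov_op_def using prob_space by simp
qed

lemma P_iterate_unit_valued: "f \<in> unit_valued \<Longrightarrow> (P ^^ k) f \<in> unit_valued"
  by (induction k) (auto intro: P_unit_valued)

lemma P_midpoint:
  "f \<in> unit_valued \<Longrightarrow> g \<in> unit_valued \<Longrightarrow> P (\<lambda>h. (f h + g h) / 2) = (\<lambda>h. (P f h + P g h) / 2)"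
  by (auto simp: markov_op_def integrable_kernel fun_eq_iff)

lemma P_complement: "f \<in> unit_valued \<Longrightarrow> P (\<lambda>h. 1 - f h) = (\<lambda>h. 1 - P f h)"
proof (rule ext)
  fix h assume f: "f \<in> unit_valued"
  interpret prob_space "\<pi> h" by (rule prob_kernel)
  show "P (\<lambda>h. 1 - f h) h = 1 - P f h"
    using integrable_kernel[OF f, of h] prob_space by (simp add: markov_op_def)
qed

lemma P_iterate_midpoint:
  "f \<in> unit_valued \<Longrightarrow> g \<in> unit_valued \<Longrightarrow>
    (P ^^ k) (\<lambda>h. (f h + g h) / 2) = (\<lambda>h. ((P ^^ k) f h + (P ^^ k) g h) / 2)"
  by (induction k) (simp_all add: P_midpoint P_iterate_unit_valued)

lemma P_iterate_complement: "f \<in> unit_valued \<Longrightarrow> (P ^^ k) (\<lambda>h. 1 - f h) = (\<lambda>h. 1 - (P ^^ k) f h)"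
  by (induction k) (simp_all add: P_complement P_iterate_unit_valued)

text \<open>
Averages of dyadic length, so that consecutive averages factor as in the lemma \<open>cesaro_Suc\<close>.
\<close>

definition cesaro :: "nat \<Rightarrow> ('a \<Rightarrow> real) \<Rightarrow> 'a \<Rightarrow> real" where
  "cesaro n f h = (\<Sum>k<2 ^ n. (P ^^ k) f h) / 2 ^ n"

lemma cesaro_unit_valued:
  assumes "f \<in> unit_valued" shows "cesaro n f \<in> unit_valued"
proof (rule unit_valuedI)
  note U = unit_valuedD[OF P_iterate_unit_valued[OF assms]]
  show "cesaro n f \<in> borel_measurable borel" unfolding cesaro_def using U(1) by measurable
  show "0 \<le> cesaro n f h" for h unfolding cesaro_def using U(2) by (simp add: sum_nonneg)
  have "(\<Sum>k<2 ^ n. (P ^^ k) f h) \<le> of_nat (card {..<2 ^ n :: nat}) * 1" for h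
    by (rule sum_bounded_above) (rule U(3))
  then show "cesaro n f h \<le> 1" for h unfolding cesaro_def by (simp add: divide_le_eq)
qed

lemma P_cesaro:
  assumes "f \<in> unit_valued"
  shows "P (cesaro n f) h = (\<Sum>k<2 ^ n. (P ^^ Suc k) f h) / 2 ^ n"
proof -
  have "P (cesaro n f) h = (\<integral>j. (\<Sum>k<2 ^ n. (P ^^ k) f j) / 2 ^ n \<partial>\<pi> h)"
    by (simp only: markov_op_def[of \<pi> "cesaro n f"] cesaro_def)
  also have "\<dots> = (\<Sum>k<2 ^ n. (\<integral>j. (P ^^ k) f j \<partial>\<pi> h)) / 2 ^ n"
    using integrable_kernel[OF P_iterate_unit_valued[OF assms]] by simp
  also have "\<dots> = (\<Sum>k<2 ^ n. (P ^^ Suc k) f h) / 2 ^ n"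
    by (simp add: markov_op_def)
  finally show ?thesis .
qed

text \<open>
The difference telescopes to its first and last term.
\<close>

lemma cesaro_almost_invariant:
  assumes "f \<in> unit_valued"
  shows "\<bar>P (cesaro n f) h - cesaro n f h\<bar> \<le> 1 / 2 ^ n"
proof -
  have "P (cesaro n f) h - cesaro n f h = (\<Sum>k<2 ^ n. (P ^^ Suc k) f h - (P ^^ k) f h) / 2 ^ n"
    unfolding P_cesaro[OF assms] by (simp add: cesaro_def sum_subtractf diff_divide_distrib)
  also have "(\<Sum>k<2 ^ n. (P ^^ Suc k) f h - (P ^^ k) f h) = (P ^^ (2 ^ n)) f h - f h"
    by (subst sum_lessThan_telescope) simp
  finally have "\<bar>P (cesaro n f) h - cesaro n f h\<bar> = \<bar>(P ^^ (2 ^ n)) f h - f h\<bar> / 2 ^ n" by simp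
  moreover have "\<bar>(P ^^ (2 ^ n)) f h - f h\<bar> \<le> 1"
    using unit_valuedD(2,3)[OF assms, of h] unit_valuedD(2,3)[OF P_iterate_unit_valued[OF assms], of "2 ^ n" h]
    by linarith
  ultimately show ?thesis by (simp add: divide_right_mono)
qed

text \<open>
Split the first \<open>2 ^ (n + 1)\<close> powers of \<open>P\<close> into two blocks of length \<open>2 ^ n\<close>.
\<close>

lemma cesaro_Suc:
  assumes "f \<in> unit_valued"
  shows "cesaro (Suc n) f = cesaro n (\<lambda>h. (f h + (P ^^ (2 ^ n)) f h) / 2)"
proof
  fix h
  have "(\<Sum>k<2 ^ Suc n. (P ^^ k) f h) = (\<Sum>k<2 ^ n. (P ^^ k) f h) + (\<Sum>k<2 ^ n. (P ^^ (k + 2 ^ n)) f h)"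
  proof -
    have "(\<Sum>k<m + m. F k) = (\<Sum>k<m. F k) + (\<Sum>k<m. F (k + m))" for F :: "nat \<Rightarrow> real" and m
      using sum.atLeastLessThan_concat[of 0 m "m + m" F] sum.shift_bounds_nat_ivl[of F 0 m m]
      by (simp add: lessThan_atLeast0)
    from this[of "\<lambda>k. (P ^^ k) f h" "2 ^ n"] show ?thesis by (simp add: mult_2)
  qed
  then show "cesaro (Suc n) f h = cesaro n (\<lambda>h. (f h + (P ^^ (2 ^ n)) f h) / 2) h"
    unfolding cesaro_def P_iterate_midpoint[OF assms P_iterate_unit_valued[OF assms]]
    by (simp add: funpow_add sum.distrib flip: sum_divide_distrib)
qed

lemma cesaro_complement:
  assumes "f \<in> unit_valued"
  shows "cesaro n (\<lambda>h. 1 - f h) = (\<lambda>h. 1 - cesaro n f h)"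
  by (rule ext) (simp add: cesaro_def P_iterate_complement[OF assms] sum_subtractf diff_divide_distrib)

text \<open>
Stated as a bound instead of a supremum. By the lemma \<open>integral_theta\<close> below, this says that
\<open>theta n g\<close> and \<open>theta n (tgt G g)\<close> differ by at most \<open>d\<close> on every Borel set.
\<close>

definition deviation_le :: "nat \<Rightarrow> 'a \<Rightarrow> real \<Rightarrow> bool" where
  "deviation_le n g d \<longleftrightarrow> (\<forall>f\<in>unit_valued. \<bar>P (cesaro n f) g - P (cesaro n f) (tgt G g)\<bar> \<le> d)"

lemma deviation_le_mono:
  assumes "deviation_le n g d" and "n \<le> m"
  shows "deviation_le m g d"
  using assms(2,1)
proof (induction rule: dec_induct)
  case (step m)
  then show ?case unfolding deviation_le_def
    by (auto simp: cesaro_Suc intro!: unit_valued_midpoint P_iterate_unit_valued)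
qed

text \<open>
Absolute continuity holds at every point of the fiber, not only at almost every one. This lets
almost everywhere statements about the fiber be evaluated at the points \<open>g\<close> and \<open>tgt G g\<close>.
\<close>

lemma AE_kernel_of_AE_lam:
  assumes "AE k in lam (tgt G h). Q k" shows "AE k in \<pi> h. Q k"
proof -
  obtain N where N: "{k \<in> space (lam (tgt G h)). \<not> Q k} \<subseteq> N" "N \<in> null_sets (lam (tgt G h))"
    using assms by (auto elim!: AE_E simp: null_sets_def)
  have "emeasure (\<pi> h) N = 0" by (rule invariant_null_sets[OF haar invariant densities N(2)])
  moreover have "N \<in> sets borel" using N(2) sets_lam[OF tgt_unit] by auto
  ultimately have "N \<in> null_sets (\<pi> h)" by (auto simp: null_sets_def)
  then show ?thesis by (rule AE_I') (use N(1) space_lam[OF tgt_unit] in auto)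
qed

lemma harmonic_constant:
  assumes L: "topologically_fiberwise_liouville G lam \<pi>" and x: "x \<in> units G"
    and u: "u \<in> borel_measurable borel" "AE h in lam x. \<bar>u h\<bar> \<le> 1" "AE h in lam x. P u h = u h"
  shows "\<exists>c. AE h in lam x. u h = c"
proof -
  let ?F = "fiber G x"
  have F: "?F \<in> sets borel" by (rule fiber_borel)
  have AE_iff: "(AE h in fiber_measure G lam x. Q h) \<longleftrightarrow> (AE h in lam x. h \<in> ?F \<longrightarrow> Q h)" for Q
    unfolding fiber_measure_def
    by (rule AE_restrict_space_iff) (use F sets_lam[OF x] in simp)
  have op: "markov_op (fiber_kernel G \<pi> x) u h = P u h" if "tgt G h = x" for h
  proof -
    have "markov_op (fiber_kernel G \<pi> x) u h = (\<integral>k. indicator ?F k *\<^sub>R u k \<partial>\<pi> h)"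
      unfolding markov_op_def fiber_kernel_def using F by (subst integral_restrict_space) auto
    also have "\<dots> = P u h" unfolding markov_op_def
      by (rule integral_cong_AE)
         (use AE_kernel[of h] that u(1) F in \<open>auto simp: fiber_def\<close>)
    finally show ?thesis .
  qed
  have "\<forall>f :: 'a \<Rightarrow> real. f \<in> borel_measurable (fiber_measure G lam x) \<longrightarrow>
        (\<exists>C. AE x in fiber_measure G lam x. \<bar>f x\<bar> \<le> C) \<longrightarrow>
        (AE h in fiber_measure G lam x. markov_op (fiber_kernel G \<pi> x) f h = f h) \<longrightarrow>
        (\<exists>c. AE h in fiber_measure G lam x. f h = c)"
    using L x unfolding topologically_fiberwise_liouville_def liouville_def by simp
  moreover have "u \<in> borel_measurable (fiber_measure G lam x)"
    unfolding fiber_measure_def by (rule measurable_restrict_space1[OF measurable_lam[OF x u(1)]])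
  moreover have "AE h in fiber_measure G lam x. \<bar>u h\<bar> \<le> 1"
    unfolding AE_iff using u(2) by eventually_elim simp
  moreover have "AE h in fiber_measure G lam x. markov_op (fiber_kernel G \<pi> x) u h = u h"
    unfolding AE_iff using u(3) by eventually_elim (simp add: op fiber_def)
  ultimately obtain c where "AE h in fiber_measure G lam x. u h = c" by blast
  then have "AE h in lam x. h \<in> ?F \<longrightarrow> u h = c" unfolding AE_iff .
  then have "AE h in lam x. u h = c" using AE_lam[OF x] by eventually_elim (simp add: fiber_def)
  then show ?thesis by blast
qed

text \<open>
If the deviation at \<open>g\<close> stays above \<open>e\<close>, the convex sets \<open>C n\<close> of almost invariant functions
whose images under \<open>P\<close> separate \<open>g\<close> from \<open>tgt G g\<close> by \<open>e\<close> are nonempty. An almost everywhere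
limit of functions from these sets is harmonic, hence constant, yet still separates the points.
\<close>

lemma exists_deviation_le:
  assumes L: "topologically_fiberwise_liouville G lam \<pi>" and e: "e > 0"
  shows "\<exists>n. deviation_le n g e"
proof (rule ccontr)
  assume no: "\<nexists>n. deviation_le n g e"
  define x where "x = tgt G g"
  have x: "x \<in> units G" and tx: "tgt G x = x" using tgt_unit tgt_units by (auto simp: x_def)
  define C where "C n = {v \<in> unit_valued. (\<forall>h. \<bar>P v h - v h\<bar> \<le> 1 / 2 ^ n) \<and> e \<le> P v g - P v x}" for n :: nat
  have Cu: "v \<in> unit_valued" if "v \<in> C n" for v n using that by (simp add: C_def)
  have "C n \<noteq> {}" for n
  proof -
    obtain f where f: "f \<in> unit_valued" "e < \<bar>P (cesaro n f) g - P (cesaro n f) x\<bar>"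
      using no unfolding deviation_le_def x_def by (auto simp: not_le)
    \<comment> \<open>Passing to \<open>1 - f\<close> changes the sign of the difference at the two points.\<close>
    have f': "(\<lambda>h. 1 - f h) \<in> unit_valued" by (rule unit_valued_complement[OF f(1)])
    have "cesaro n f \<in> C n" if "e \<le> P (cesaro n f) g - P (cesaro n f) x"
      unfolding C_def using that cesaro_almost_invariant[OF f(1)] cesaro_unit_valued[OF f(1)] by blast
    moreover have "cesaro n (\<lambda>h. 1 - f h) \<in> C n" if "e \<le> P (cesaro n f) x - P (cesaro n f) g"
    proof -
      have "e \<le> P (cesaro n (\<lambda>h. 1 - f h)) g - P (cesaro n (\<lambda>h. 1 - f h)) x"
        using that unfolding cesaro_complement[OF f(1)] P_complement[OF cesaro_unit_valued[OF f(1)]] by simp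
      then show ?thesis
        unfolding C_def using cesaro_almost_invariant[OF f'] cesaro_unit_valued[OF f'] by blast
    qed
    moreover have "e \<le> P (cesaro n f) g - P (cesaro n f) x \<or> e \<le> P (cesaro n f) x - P (cesaro n f) g"
      using f(2) by linarith
    ultimately have "cesaro n f \<in> C n \<or> cesaro n (\<lambda>h. 1 - f h) \<in> C n" by blast
    then show ?thesis by blast
  qed
  moreover have "decseq C"
  proof (rule decseq_SucI)
    show "C (Suc n) \<le> C n" for n
    proof
      fix v assume "v \<in> C (Suc n)"
      moreover have "1 / 2 ^ Suc n \<le> (1 :: real) / 2 ^ n" by (simp add: field_simps)
      ultimately show "v \<in> C n" by (auto simp: C_def intro: order_trans)
    qed
  qed
  moreover have "(\<lambda>h. (u h + v h) / 2) \<in> C n" if "u \<in> C n" "v \<in> C n" for u v n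
  proof -
    have uv: "u \<in> unit_valued" "v \<in> unit_valued" using that Cu by auto
    have "\<bar>(P u h + P v h) / 2 - (u h + v h) / 2\<bar> \<le> 1 / 2 ^ n" for h
    proof -
      have "\<bar>P u h - u h\<bar> \<le> 1 / 2 ^ n" "\<bar>P v h - v h\<bar> \<le> 1 / 2 ^ n" using that by (auto simp: C_def)
      then have "\<bar>(P u h - u h) + (P v h - v h)\<bar> \<le> 1 / 2 ^ n + 1 / 2 ^ n"
        by (intro order_trans[OF abs_triangle_ineq] add_mono)
      moreover have "(P u h + P v h) / 2 - (u h + v h) / 2 = ((P u h - u h) + (P v h - v h)) / 2"
        by (simp add: field_simps)
      moreover have "\<bar>s / 2\<bar> \<le> t" if "\<bar>s\<bar> \<le> t + t" for s t :: real using that by simp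
      ultimately show ?thesis by metis
    qed
    moreover have "e \<le> (P u g + P v g) / 2 - (P u x + P v x) / 2"
    proof -
      have "e \<le> P u g - P u x" "e \<le> P v g - P v x" using that by (auto simp: C_def)
      then have "e + e \<le> (P u g - P u x) + (P v g - P v x)" by (rule add_mono)
      then show ?thesis by argo
    qed
    ultimately show ?thesis
      using uv by (simp add: C_def unit_valued_midpoint P_midpoint)
  qed
  moreover obtain w where w: "w \<in> borel_measurable (lam x)" "\<And>h. w h > (0::real)" "integrable (lam x) w"
    using sigma_finite_measure.obtain_positive_integrable_function[OF sigma_finite_haar[OF haar x]] by metis
  \<comment> \<open>A finite measure with the same null sets as the Haar measure of the fiber.\<close>
  define M where "M = density (lam x) (\<lambda>h. ennreal (w h))"
  have "finite_measure M"
  proof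
    have "emeasure M (space M) = (\<integral>\<^sup>+h. ennreal (w h) \<partial>lam x)"
      unfolding M_def using w(1) by (subst emeasure_density) (auto simp: space_lam[OF x] sets_lam[OF x])
    also have "\<dots> = ennreal (\<integral>h. w h \<partial>lam x)"
      using w by (intro nn_integral_eq_integral) (auto simp: less_imp_le)
    finally show "emeasure M (space M) \<noteq> \<infinity>" by simp
  qed
  have AE_M: "(AE h in M. Q h) \<longleftrightarrow> (AE h in lam x. Q h)" for Q
    unfolding M_def using w(1,2) by (subst AE_density) auto
  have meas_M: "v \<in> borel_measurable M" if "v \<in> C n" for v n
    unfolding M_def using measurable_lam[OF x unit_valuedD(1)[OF Cu[OF that]]] by simp
  have bd: "0 \<le> v h \<and> v h \<le> 1" if "v \<in> C n" for v n h using unit_valuedD[OF Cu[OF that]] by simp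
  obtain v where v: "\<And>k. v k \<in> C k" and "AE h in M. Cauchy (\<lambda>k. v k h)"
    by (rule midpoint_convex_AE_Cauchy[of M C])
       (use \<open>finite_measure M\<close> calculation meas_M bd in auto)
  then have cau: "AE h in lam x. Cauchy (\<lambda>k. v k h)" by (simp add: AE_M)
  note vu = Cu[OF v]
  define u where "u h = lim (\<lambda>k. v k h)" for h
  have um: "u \<in> borel_measurable borel"
    unfolding u_def using unit_valuedD(1)[OF vu] by (rule borel_measurable_lim_metric)
  have conv: "AE h in lam x. (\<lambda>k. v k h) \<longlonglongrightarrow> u h"
    using cau by eventually_elim (simp add: u_def Cauchy_convergent_iff convergent_LIMSEQ_iff)
  have bound: "AE h in lam x. \<bar>u h\<bar> \<le> 1"
    using conv
  proof eventually_elim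
    case (elim h)
    have "(\<lambda>k. \<bar>v k h\<bar>) \<longlonglongrightarrow> \<bar>u h\<bar>" using elim by (rule tendsto_rabs)
    then show ?case
      by (rule LIMSEQ_le_const2) (use unit_valuedD(2,3)[OF vu] in \<open>auto simp: abs_of_nonneg\<close>)
  qed
  have convP: "(\<lambda>k. P (v k) h) \<longlonglongrightarrow> P u h" if h: "tgt G h = x" for h
    unfolding markov_op_def
  proof (rule integral_dominated_convergence[where w = "\<lambda>_. 1"])
    interpret prob_space "\<pi> h" by (rule prob_kernel)
    show "integrable (\<pi> h) (\<lambda>_. 1 :: real)" by simp
    show "AE k in \<pi> h. (\<lambda>i. v i k) \<longlonglongrightarrow> u k"
      by (rule AE_kernel_of_AE_lam) (unfold h, rule conv)
  qed (use um unit_valuedD[OF vu] in \<open>auto simp: abs_of_nonneg\<close>)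
  have "AE h in lam x. P u h = u h"
    using conv AE_lam[OF x]
  proof eventually_elim
    case (elim h)
    have "(\<lambda>k. P (v k) h - v k h) \<longlonglongrightarrow> P u h - u h" by (intro tendsto_diff convP elim)
    moreover have "(\<lambda>k. P (v k) h - v k h) \<longlonglongrightarrow> 0"
    proof (rule Lim_null_comparison)
      show "\<forall>\<^sub>F k in sequentially. norm (P (v k) h - v k h) \<le> (1 / 2) ^ k"
        using v by (auto simp: C_def power_divide)
      show "(\<lambda>k. (1 / 2) ^ k :: real) \<longlonglongrightarrow> 0" by (rule LIMSEQ_power_zero) simp
    qed
    ultimately have "P u h - u h = 0" by (rule LIMSEQ_unique)
    then show ?case by simp
  qed
  then obtain c where c: "AE h in lam x. u h = c" using harmonic_constant[OF L x um bound] by blast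
  have Pc: "P u h = c" if h: "tgt G h = x" for h
  proof -
    interpret prob_space "\<pi> h" by (rule prob_kernel)
    have "AE k in \<pi> h. u k = c" by (rule AE_kernel_of_AE_lam) (unfold h, rule c)
    then have "P u h = (\<integral>k. c \<partial>\<pi> h)" unfolding markov_op_def using um by (intro integral_cong_AE) auto
    then show ?thesis using prob_space by simp
  qed
  have "(\<lambda>k. P (v k) g - P (v k) x) \<longlonglongrightarrow> P u g - P u x"
    by (intro tendsto_diff convP) (auto simp: tx x_def[symmetric])
  then have "e \<le> P u g - P u x" by (rule LIMSEQ_le_const) (use v in \<open>auto simp: C_def\<close>)
  then show False using e Pc[of g] Pc[of x] tx by (simp add: x_def[symmetric])
qed

end

section \<open>The averaged transition measures\<close>

text \<open>
Group the cells of a partition by the sign of the difference; each group contributes the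
difference on its union.
\<close>

lemma total_variation_diff_bounds:
  assumes M: "finite_measure M" and N: "finite_measure N" and sets: "sets N = sets M"
    and d: "\<And>A. A \<in> sets M \<Longrightarrow> \<bar>measure M A - measure N A\<bar> \<le> d"
  shows "0 \<le> total_variation_diff M N" and "total_variation_diff M N \<le> 2 * d"
proof -
  interpret M: finite_measure M by fact
  interpret N: finite_measure N by fact
  let ?Q = "{Q. finite Q \<and> Q \<subseteq> sets M \<and> partition_on (space M) Q}"
  let ?s = "\<lambda>Q. \<Sum>A\<in>Q. \<bar>measure M A - measure N A\<bar>"
  have part: "(\<Sum>A\<in>R. measure M A - measure N A) = measure M (\<Union>R) - measure N (\<Union>R)" "\<Union>R \<in> sets M"
    if Q: "Q \<in> ?Q" and R: "R \<subseteq> Q" for Q R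
  proof -
    have fin: "finite R" and RM: "R \<subseteq> sets M"
      using Q R finite_subset[of R Q] by auto
    have dj: "disjoint_family_on (\<lambda>A. A) R"
      using Q R unfolding partition_on_def disjoint_def disjoint_family_on_def by blast
    show "\<Union>R \<in> sets M" using fin RM by (rule sets.finite_Union)
    have "measure M (\<Union>A\<in>R. A) = (\<Sum>A\<in>R. measure M A)"
      by (rule M.finite_measure_finite_Union[OF fin _ dj]) (use RM in auto)
    moreover have "measure N (\<Union>A\<in>R. A) = (\<Sum>A\<in>R. measure N A)"
      by (rule N.finite_measure_finite_Union[OF fin _ dj]) (use RM sets in auto)
    ultimately show "(\<Sum>A\<in>R. measure M A - measure N A) = measure M (\<Union>R) - measure N (\<Union>R)"
      by (simp add: sum_subtractf)
  qed
  have le: "?s Q \<le> 2 * d" if Q: "Q \<in> ?Q" for Q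
  proof -
    let ?R = "{A \<in> Q. measure N A \<le> measure M A}"
    have fin: "finite Q" using Q by simp
    have "?s Q = (\<Sum>A\<in>?R. \<bar>measure M A - measure N A\<bar>) + (\<Sum>A\<in>Q - ?R. \<bar>measure M A - measure N A\<bar>)"
      using fin by (subst sum.subset_diff[of ?R Q]) auto
    also have "(\<Sum>A\<in>?R. \<bar>measure M A - measure N A\<bar>) = (\<Sum>A\<in>?R. measure M A - measure N A)"
      by (rule sum.cong) auto
    also have "(\<Sum>A\<in>Q - ?R. \<bar>measure M A - measure N A\<bar>) = (\<Sum>A\<in>Q - ?R. - (measure M A - measure N A))"
      by (rule sum.cong) auto
    also have "\<dots> = - (\<Sum>A\<in>Q - ?R. measure M A - measure N A)" by (rule sum_negf)
    also have "(\<Sum>A\<in>?R. measure M A - measure N A) \<le> d"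
      using part[OF Q, of ?R] d[of "\<Union>?R"] by auto
    also have "- (\<Sum>A\<in>Q - ?R. measure M A - measure N A) \<le> d"
      using part[OF Q, of "Q - ?R"] d[of "\<Union>(Q - ?R)"] by auto
    finally show ?thesis by simp
  qed
  have Q0: "{space M} - {{}} \<in> ?Q" by (auto simp: partition_on_def disjoint_def)
  then show "total_variation_diff M N \<le> 2 * d"
    unfolding total_variation_diff_def using le by (intro cSUP_least) auto
  have "0 \<le> ?s ({space M} - {{}})" by (simp add: sum_nonneg)
  then show "0 \<le> total_variation_diff M N"
    unfolding total_variation_diff_def
    using Q0 le by (intro cSUP_upper2[OF _ Q0]) (auto intro!: bdd_aboveI[of _ "2 * d"])
qed

text \<open>
The lower bound for \<open>1 - f\<close> is an upper bound for \<open>f\<close>, with the missing mass as error.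
\<close>

lemma subdensity_sandwich:
  assumes \<theta>: "prob_space \<theta>" "sets \<theta> = sets borel" and M: "sets M = sets borel"
    and r: "integrable M r" "\<And>h. 0 \<le> r h" 
    and le: "\<And>f :: 'a::topological_space \<Rightarrow> ennreal. f \<in> borel_measurable borel \<Longrightarrow>
      (\<integral>\<^sup>+h. ennreal (r h) * f h \<partial>M) \<le> (\<integral>\<^sup>+h. f h \<partial>\<theta>)"
    and f: "f \<in> unit_valued"
  shows "(\<integral>h. r h * f h \<partial>M) \<le> (\<integral>h. f h \<partial>\<theta>)"
    and "(\<integral>h. f h \<partial>\<theta>) \<le> (\<integral>h. r h * f h \<partial>M) + (1 - (\<integral>h. r h \<partial>M))"
    and "integrable M (\<lambda>h. r h * f h)"
proof -
  interpret prob_space \<theta> by fact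
  have int: "integrable M (\<lambda>h. r h * u h)" if "u \<in> unit_valued" for u
  proof (rule Bochner_Integration.integrable_bound[OF r(1)])
    have "u \<in> borel_measurable M" using unit_valuedD(1)[OF that] M by (simp cong: measurable_cong_sets)
    then show "(\<lambda>h. r h * u h) \<in> borel_measurable M" using r(1) by measurable
    show "AE h in M. norm (r h * u h) \<le> norm (r h)"
      using unit_valuedD(2,3)[OF that] r(2) by (auto simp: mult_left_le)
  qed
  have low: "(\<integral>h. r h * u h \<partial>M) \<le> (\<integral>h. u h \<partial>\<theta>)" if u: "u \<in> unit_valued" for u
  proof -
    have "ennreal (\<integral>h. r h * u h \<partial>M) = (\<integral>\<^sup>+h. ennreal (r h) * ennreal (u h) \<partial>M)"
      using int[OF u] r(2) unit_valuedD(2)[OF u] by (subst nn_integral_eq_integral[symmetric]) (auto simp: ennreal_mult)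
    also have "\<dots> \<le> (\<integral>\<^sup>+h. ennreal (u h) \<partial>\<theta>)"
      by (rule le) (use unit_valuedD(1)[OF u] in measurable)
    also have "\<dots> = ennreal (\<integral>h. u h \<partial>\<theta>)"
      by (rule nn_integral_unit_valued[OF _ \<theta>(2) u]) unfold_locales
    finally show ?thesis
      using unit_valuedD(2)[OF u] by (subst (asm) ennreal_le_iff) auto
  qed
  show "(\<integral>h. r h * f h \<partial>M) \<le> (\<integral>h. f h \<partial>\<theta>)" by (rule low[OF f])
  show "integrable M (\<lambda>h. r h * f h)" by (rule int[OF f])
  have if\<theta>: "integrable \<theta> f"
    by (rule integrable_unit_valued[OF _ \<theta>(2) f]) unfold_locales
  have "(\<integral>h. r h * (1 - f h) \<partial>M) = (\<integral>h. r h \<partial>M) - (\<integral>h. r h * f h \<partial>M)"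
    using r(1) int[OF f] by (simp add: right_diff_distrib)
  moreover have "(\<integral>h. 1 - f h \<partial>\<theta>) = 1 - (\<integral>h. f h \<partial>\<theta>)"
    using if\<theta> prob_space by simp
  ultimately show "(\<integral>h. f h \<partial>\<theta>) \<le> (\<integral>h. r h * f h \<partial>M) + (1 - (\<integral>h. r h \<partial>M))"
    using low[OF unit_valued_complement[OF f]] by simp
qed

context invariant_markov_operator
begin

text \<open>
Since \<open>step k\<close> makes \<open>k + 1\<close> steps, the number of steps is uniform in \<open>{1..2 ^ n}\<close>.
\<close>

definition theta :: "nat \<Rightarrow> 'a \<Rightarrow> 'a measure" where
  "theta n h = measure_pmf (pmf_of_set {..<2 ^ n}) \<bind> (\<lambda>k. step k h)"

lemma step_count_space: "(\<lambda>k. step k h) \<in> measure_pmf (pmf_of_set A) \<rightarrow>\<^sub>M prob_algebra borel"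
  by (simp add: space_prob_algebra prob_step)

lemma prob_theta: "prob_space (theta n h)" and sets_theta[simp, measurable_cong]: "sets (theta n h) = sets borel"
proof -
  show "prob_space (theta n h)"
    unfolding theta_def
    by (rule prob_space.prob_space_bind[OF measure_pmf.prob_space_axioms _
          measurable_prob_algebraD[OF step_count_space]])
       (simp add: prob_step)
  show "sets (theta n h) = sets borel" unfolding theta_def by (rule sets_bind) auto
qed

lemma finite_theta: "finite_measure (theta n h)"
  using prob_theta by (simp add: prob_space_def)

lemma nn_integral_theta:
  assumes "f \<in> borel_measurable borel"
  shows "(\<integral>\<^sup>+k. f k \<partial>theta n h) = (\<Sum>k<2 ^ n. (\<integral>\<^sup>+j. f j \<partial>step k h)) / 2 ^ n"
proof -
  have "(\<integral>\<^sup>+k. f k \<partial>theta n h) = (\<integral>\<^sup>+k. (\<integral>\<^sup>+j. f j \<partial>step k h) \<partial>measure_pmf (pmf_of_set {..<2 ^ n}))"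
    unfolding theta_def
    by (rule nn_integral_bind[OF assms measurable_prob_algebraD[OF step_count_space]])
  also have "\<dots> = (\<Sum>k<2 ^ n. (\<integral>\<^sup>+j. f j \<partial>step k h)) / 2 ^ n"
    by (subst nn_integral_pmf_of_set) (auto simp: lessThan_empty_iff)
  finally show ?thesis .
qed

lemma nn_integral_step:
  assumes "f \<in> unit_valued"
  shows "(\<integral>\<^sup>+j. ennreal (f j) \<partial>step k h) = ennreal ((P ^^ Suc k) f h)"
  using assms
proof (induction k arbitrary: f)
  case 0
  have "finite_measure (\<pi> h)" using prob_kernel[of h] by (simp add: prob_space_def)
  from nn_integral_unit_valued[OF this _ 0] show ?case by (simp add: markov_op_def)
next
  case (Suc k)
  have fin: "finite_measure (\<pi> j)" for j using prob_kernel[of j] by (simp add: prob_space_def)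
  have "(\<integral>\<^sup>+j. ennreal (f j) \<partial>step (Suc k) h) = (\<integral>\<^sup>+j. (\<integral>\<^sup>+l. ennreal (f l) \<partial>\<pi> j) \<partial>step k h)"
    by (rule nn_integral_step_Suc) (use unit_valuedD(1)[OF Suc.prems] in measurable)
  also have "\<dots> = (\<integral>\<^sup>+j. ennreal (P f j) \<partial>step k h)"
    using nn_integral_unit_valued[OF fin _ Suc.prems] by (simp add: markov_op_def)
  also have "\<dots> = ennreal ((P ^^ Suc k) (P f) h)" by (rule Suc.IH[OF P_unit_valued[OF Suc.prems]])
  also have "(P ^^ Suc k) (P f) = (P ^^ Suc (Suc k)) f" by (simp only: funpow_Suc_right o_apply)
  finally show ?case .
qed

lemma integral_theta:
  assumes f: "f \<in> unit_valued"
  shows "(\<integral>k. f k \<partial>theta n h) = P (cesaro n f) h"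
proof -
  note U = unit_valuedD[OF P_iterate_unit_valued[OF f]]
  have "ennreal (\<integral>k. f k \<partial>theta n h) = (\<integral>\<^sup>+k. ennreal (f k) \<partial>theta n h)"
    by (rule nn_integral_unit_valued[OF finite_theta sets_theta f, symmetric])
  also have "\<dots> = (\<Sum>k<2 ^ n. ennreal ((P ^^ Suc k) f h)) / 2 ^ n"
    using unit_valuedD(1)[OF f] by (subst nn_integral_theta) (simp_all add: nn_integral_step[OF f] del: funpow.simps)
  also have "\<dots> = ennreal (P (cesaro n f) h)"
    unfolding P_cesaro[OF f]
    using U(2)[of "Suc _"] by (simp add: sum_ennreal sum_nonneg divide_ennreal[symmetric] ennreal_power[symmetric] del: funpow.simps)
  finally show ?thesis
    using unit_valuedD(2)[OF P_unit_valued[OF cesaro_unit_valued[OF f]]] unit_valuedD(2)[OF f]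
    by (subst (asm) ennreal_inj) auto
qed

abbreviation left_translate :: "'a \<Rightarrow> ('a \<Rightarrow> ennreal) \<Rightarrow> 'a \<Rightarrow> ennreal" where
  "left_translate g f l \<equiv> f (mul G g l) * indicator (fiber G (src G g)) l"

text \<open>
Invariance of one step carries over by induction. Off the fiber over \<open>src G g\<close>, where
\<open>mul G g\<close> is meaningless, both sides of the induction step vanish.
\<close>

lemma nn_integral_step_mul:
  assumes "f \<in> borel_measurable borel" and "tgt G h = src G g"
  shows "(\<integral>\<^sup>+j. f j \<partial>step k (mul G g h)) = (\<integral>\<^sup>+j. left_translate g f j \<partial>step k h)"
  using assms(1)
proof (induction k arbitrary: f)
  case base: 0
  show ?case
    using kernel_translate[of g h] assms(2) nn_integral_translate[OF sets_kernel base, of g h] by simp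
next
  case (Suc k)
  note [measurable] = Suc.prems
  have k: "(\<integral>\<^sup>+i. f i \<partial>\<pi> (mul G g l)) * indicator (fiber G (src G g)) l = (\<integral>\<^sup>+i. left_translate g f i \<partial>\<pi> l)" for l
  proof (cases "tgt G l = src G g")
    case True
    then show ?thesis
      using kernel_translate[of g l] nn_integral_translate[OF sets_kernel Suc.prems, of g l]
      by (simp add: fiber_def)
  next
    case False
    have "(\<integral>\<^sup>+i. left_translate g f i \<partial>\<pi> l) = (\<integral>\<^sup>+i. 0 \<partial>\<pi> l)"
    proof (rule nn_integral_cong_AE)
      show "AE i in \<pi> l. left_translate g f i = 0"
        using AE_kernel[of l] by eventually_elim (use False in \<open>auto simp: fiber_def\<close>)
    qed
    then show ?thesis using False by (simp add: fiber_def)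
  qed
  have m: "(\<lambda>l. \<integral>\<^sup>+i. f i \<partial>\<pi> l) \<in> borel_measurable borel" by measurable
  have "(\<integral>\<^sup>+j. f j \<partial>step (Suc k) (mul G g h)) = (\<integral>\<^sup>+j. left_translate g (\<lambda>l. \<integral>\<^sup>+i. f i \<partial>\<pi> l) j \<partial>step k h)"
    unfolding nn_integral_step_Suc[OF Suc.prems] by (rule Suc.IH[OF m])
  also have "\<dots> = (\<integral>\<^sup>+j. left_translate g f j \<partial>step (Suc k) h)"
    unfolding k by (rule nn_integral_step_Suc[OF measurable_left_translation[OF Suc.prems], symmetric])
  finally show ?case .
qed

lemma nn_integral_theta_translate:
  assumes f: "f \<in> borel_measurable borel"
  shows "(\<integral>\<^sup>+j. f j \<partial>theta n g) = (\<integral>\<^sup>+j. left_translate g f j \<partial>theta n (src G g))"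
proof -
  have "mul G g (src G g) = g" "tgt G (src G g) = src G g"
    using mul_src tgt_units[OF src_unit] by auto
  then show ?thesis
    using nn_integral_step_mul[OF f, of "src G g" g]
    by (simp add: nn_integral_theta f measurable_left_translation)
qed

lemma translate_theta: "translate G g (theta n (src G g)) = theta n g"
proof (rule measure_eqI)
  show "sets (translate G g (theta n (src G g))) = sets (theta n g)" by (simp add: translate_def)
  fix A assume "A \<in> sets (translate G g (theta n (src G g)))"
  then have A[measurable]: "A \<in> sets borel" by (simp add: translate_def)
  have "emeasure (translate G g (theta n (src G g))) A = (\<integral>\<^sup>+j. indicator A j \<partial>translate G g (theta n (src G g)))"
    using A by (simp add: translate_def)
  also have "\<dots> = (\<integral>\<^sup>+j. left_translate g (indicator A) j \<partial>theta n (src G g))"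
    by (rule nn_integral_translate) auto
  also have "\<dots> = (\<integral>\<^sup>+j. indicator A j \<partial>theta n g)"
    by (rule nn_integral_theta_translate[symmetric]) simp
  also have "\<dots> = emeasure (theta n g) A" using A by simp
  finally show "emeasure (translate G g (theta n (src G g))) A = emeasure (theta n g) A" .
qed

text \<open>
Translation by a unit \<open>x\<close> first restricts the measure to the fiber over \<open>x\<close> and then leaves it
unchanged, so the invariance under translation, read at
\<open>g = x\<close>, says that \<open>theta n x\<close> has no mass off this fiber.
\<close>

lemma theta_on_fiber:
  assumes x: "x \<in> units G" shows "measure_on_fiber G x (theta n x)"
proof -
  have F[measurable]: "fiber G x \<in> sets borel" by (rule fiber_borel)
  have "(\<integral>\<^sup>+j. indicator (- fiber G x) j \<partial>theta n x) = (\<integral>\<^sup>+j. left_translate x (indicator (- fiber G x)) j \<partial>theta n (src G x))"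
    by (rule nn_integral_theta_translate) simp
  also have "\<dots> = (\<integral>\<^sup>+j. 0 \<partial>theta n (src G x))"
  proof (rule nn_integral_cong)
    fix j
    show "left_translate x (indicator (- fiber G x)) j = 0"
      using tgt_mul[of x j] src_units[OF x] tgt_units[OF x] by (auto simp: indicator_def fiber_def)
  qed
  finally have "emeasure (theta n x) (- fiber G x) = 0" by simp
  then have "AE h in theta n x. h \<in> fiber G x"
    by (intro AE_I[where N = "- fiber G x"]) auto
  then show ?thesis by (simp add: measure_on_fiber_def)
qed

lemma exists_theta_subdensity:
  assumes C: "compact C" "C \<subseteq> units G" and e: "e > 0"
  obtains q where "compactly_supported_continuous q" "\<And>h. 0 \<le> q h"
    "\<And>x f. x \<in> units G \<Longrightarrow> f \<in> borel_measurable borel \<Longrightarrow>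
      (\<integral>\<^sup>+h. ennreal (q h) * f h \<partial>lam x) \<le> (\<integral>\<^sup>+h. f h \<partial>theta n x)"
    "\<And>x. x \<in> C \<Longrightarrow> 1 - e < (\<integral>h. q h \<partial>lam x)"
proof -
  have "\<forall>k. \<exists>q. subdensity k q \<and> (\<forall>x\<in>C. 1 - e < (\<integral>h. q h \<partial>lam x))"
    using exists_subdensity[OF C e] by blast
  from choice[OF this] obtain r where r: "\<And>k. subdensity k (r k)"
      "\<And>k x. x \<in> C \<Longrightarrow> 1 - e < (\<integral>h. r k h \<partial>lam x)" by blast
  have rc: "compactly_supported_continuous (r k)" and r0: "0 \<le> r k h" for k h
    using r(1)[of k] by (auto simp: subdensity_def)
  have rle: "(\<integral>\<^sup>+h. ennreal (r k h) * f h \<partial>lam x) \<le> (\<integral>\<^sup>+h. f h \<partial>step k x)"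
    if "x \<in> units G" "f \<in> borel_measurable borel" for k x f
    using r(1)[of k] that by (auto simp: subdensity_def)
  define q where "q h = (1 / 2 ^ n) * (\<Sum>k<2 ^ n. r k h)" for h
  show thesis
  proof (rule that[of q])
    show "compactly_supported_continuous q" unfolding q_def
      by (intro compactly_supported_continuous_mult compactly_supported_continuous_sum rc continuous_intros)
    show "0 \<le> q h" for h unfolding q_def by (simp add: sum_nonneg r0)
    show "(\<integral>\<^sup>+h. ennreal (q h) * f h \<partial>lam x) \<le> (\<integral>\<^sup>+h. f h \<partial>theta n x)"
      if x: "x \<in> units G" and f: "f \<in> borel_measurable borel" for x f
    proof -
      have rm: "(\<lambda>h. ennreal (r k h) * f h) \<in> borel_measurable (lam x)" for k
        using measurable_lam[OF x f] integrable_csc[OF x rc[of k]] by measurable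
      have "ennreal (q h) * f h = (\<Sum>k<2 ^ n. ennreal (r k h) * f h) / 2 ^ n" for h
      proof -
        have "ennreal (q h) = (\<Sum>k<2 ^ n. ennreal (r k h)) / 2 ^ n"
          unfolding q_def
          by (simp add: sum_ennreal r0 sum_nonneg divide_ennreal[symmetric] ennreal_power[symmetric])
        then show ?thesis
          unfolding divide_ennreal_def sum_distrib_right[symmetric] by (simp only: mult_ac)
      qed
      then have "(\<integral>\<^sup>+h. ennreal (q h) * f h \<partial>lam x) = (\<integral>\<^sup>+h. (\<Sum>k<2 ^ n. ennreal (r k h) * f h) / 2 ^ n \<partial>lam x)"
        by simp
      also have "\<dots> = (\<Sum>k<2 ^ n. (\<integral>\<^sup>+h. ennreal (r k h) * f h \<partial>lam x)) / 2 ^ n"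
        using rm by (simp add: nn_integral_divide nn_integral_sum)
      also have "\<dots> \<le> (\<Sum>k<2 ^ n. (\<integral>\<^sup>+h. f h \<partial>step k x)) / 2 ^ n"
        by (intro divide_right_mono_ennreal sum_mono rle x f)
      also have "\<dots> = (\<integral>\<^sup>+h. f h \<partial>theta n x)" by (rule nn_integral_theta[OF f, symmetric])
      finally show ?thesis .
    qed
    show "1 - e < (\<integral>h. q h \<partial>lam x)" if x: "x \<in> C" for x
    proof -
      have xu: "x \<in> units G" using x C by blast
      have "(\<integral>h. q h \<partial>lam x) = (1 / 2 ^ n) * (\<Sum>k<2 ^ n. (\<integral>h. r k h \<partial>lam x))"
        unfolding q_def using integrable_csc[OF xu rc] by simp
      moreover have "(\<Sum>k<2 ^ n. (\<integral>h. r k h \<partial>lam x)) > (\<Sum>k<(2 ^ n :: nat). 1 - e)"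
        by (rule sum_strict_mono) (use r(2)[OF x] in \<open>auto simp: lessThan_empty_iff\<close>)
      ultimately show ?thesis by (simp add: pos_less_divide_eq mult.commute)
    qed
  qed
qed

text \<open>
Near a given unit the integral is uniformly approximated by the continuous function
\<open>x \<mapsto> \<integral>h. q h * u h \<partial>lam x\<close>, with the missing mass of \<open>q\<close> as error.
\<close>

lemma continuous_system_theta: "continuous_system G (theta n)"
  unfolding continuous_system_def
proof (intro allI impI)
  fix f :: "'a \<Rightarrow> real" assume f: "compactly_supported_continuous f"
  obtain B where B: "B > 0" "\<And>h. \<bar>f h\<bar> \<le> B" using compactly_supported_continuous_bounded[OF f] by auto
  have fc: "continuous_on UNIV f" using f by (simp add: compactly_supported_continuous_def)
  \<comment> \<open>Rescale \<open>f\<close> so that it takes values in \<open>[0, 1]\<close>.\<close>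
  define u where "u h = (f h / B + 1) / 2" for h
  have u: "u \<in> unit_valued"
  proof (rule unit_valuedI)
    show "u \<in> borel_measurable borel" unfolding u_def
      using borel_measurable_continuous_onI[OF fc] by measurable
    show "0 \<le> u h" "u h \<le> 1" for h
      using B(1) B(2)[of h] by (auto simp: u_def field_simps abs_le_iff)
  qed
  have fu: "f h = B * (2 * u h - 1)" for h using B(1) by (simp add: u_def field_simps)
  let ?I = "\<lambda>x. \<integral>h. u h \<partial>theta n x"
  have "(?I \<longlongrightarrow> ?I x) (at x within units G)" if x: "x \<in> units G" for x
  proof (rule tendstoI)
    fix e :: real assume e: "e > 0"
    have "e / 4 > 0" using e by simp
    obtain q where q: "compactly_supported_continuous q" "\<And>h. 0 \<le> q h"
      "\<And>x f. x \<in> units G \<Longrightarrow> f \<in> borel_measurable borel \<Longrightarrow>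
        (\<integral>\<^sup>+h. ennreal (q h) * f h \<partial>lam x) \<le> (\<integral>\<^sup>+h. f h \<partial>theta n x)"
      "\<And>y. y \<in> {x} \<Longrightarrow> 1 - e / 4 < (\<integral>h. q h \<partial>lam y)"
      using exists_theta_subdensity[OF compact_sing[of x] _ \<open>e / 4 > 0\<close>, of n] x by blast
    have near: "\<bar>?I y - (\<integral>h. q h * u h \<partial>lam y)\<bar> \<le> e / 4"
      if y: "y \<in> units G" "1 - e / 4 < (\<integral>h. q h \<partial>lam y)" for y
    proof -
      note S = subdensity_sandwich[OF prob_theta sets_theta sets_lam[OF y(1)] integrable_csc[OF y(1) q(1)] q(2) q(3)[OF y(1)] u]
      show ?thesis using S(1,2) y(2) by linarith
    qed
    have uc: "continuous_on UNIV u" unfolding u_def by (intro continuous_intros fc) (use B(1) in auto)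
    have cont: "((\<lambda>y. \<integral>h. v h \<partial>lam y) \<longlongrightarrow> (\<integral>h. v h \<partial>lam x)) (at x within units G)"
      if "compactly_supported_continuous v" for v
      using continuous_lam that x by (simp add: continuous_system_def continuous_on_def)
    have "compactly_supported_continuous (\<lambda>h. q h * u h)"
      using compactly_supported_continuous_mult[OF uc q(1)] by (simp add: mult.commute)
    from tendstoD[OF cont[OF this], of "e / 4"]
    have "\<forall>\<^sub>F y in at x within units G. dist (\<integral>h. q h * u h \<partial>lam y) (\<integral>h. q h * u h \<partial>lam x) < e / 4"
      using e by simp
    moreover have "\<forall>\<^sub>F y in at x within units G. 1 - e / 4 < (\<integral>h. q h \<partial>lam y)"
      by (rule order_tendstoD(1)[OF cont[OF q(1)]]) (use q(4) in simp)
    moreover have "\<forall>\<^sub>F y in at x within units G. y \<in> units G"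
      by (simp add: eventually_at_filter)
    ultimately show "\<forall>\<^sub>F y in at x within units G. dist (?I y) (?I x) < e"
    proof eventually_elim
      case (elim y)
      have "\<bar>?I y - (\<integral>h. q h * u h \<partial>lam y)\<bar> \<le> e / 4" "\<bar>?I x - (\<integral>h. q h * u h \<partial>lam x)\<bar> \<le> e / 4"
        using near[OF elim(3,2)] near[OF x] q(4) by auto
      then show ?case using elim(1) e unfolding dist_real_def by linarith
    qed
  qed
  then have cI: "continuous_on (units G) ?I" by (simp add: continuous_on_def)
  have "(\<integral>h. f h \<partial>theta n x) = B * (2 * ?I x - 1)" for x
  proof -
    interpret prob_space "theta n x" by (rule prob_theta)
    show ?thesis unfolding fu
      using integrable_unit_valued[OF finite_theta sets_theta u, of n x] prob_space by simp
  qed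
  then show "continuous_on (units G) (\<lambda>x. \<integral>h. f h \<partial>theta n x)"
    using cI by (simp add: continuous_intros)
qed

end

section \<open>Semicontinuity of the deviation\<close>

context invariant_markov_operator
begin

definition translated :: "('a \<Rightarrow> real) \<Rightarrow> 'a \<Rightarrow> 'a \<Rightarrow> real" where
  "translated q g h = (if tgt G g = tgt G h then q (ldiv G g h) else 0)"

text \<open>
The \<open>L\<^sup>1\<close> distance between \<open>q\<close> and its translate by \<open>g\<close>: a continuous substitute for the deviation.
\<close>

definition displacement :: "('a \<Rightarrow> real) \<Rightarrow> 'a \<Rightarrow> real" where
  "displacement q g = (\<integral>h. \<bar>translated q g h - q h\<bar> \<partial>lam (tgt G g))"

context
  fixes q :: "'a \<Rightarrow> real"
  assumes qc: "compactly_supported_continuous q"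
begin

lemma continuous_q: "continuous_on UNIV q"
  using qc by (simp add: compactly_supported_continuous_def)

lemma continuous_q_ldiv: "continuous_on (fibered_pairs G) (\<lambda>(g, h). q (ldiv G g h))"
proof -
  have "continuous_on (fibered_pairs G) (\<lambda>p. q ((\<lambda>(g, h). ldiv G g h) p))"
    by (rule continuous_on_compose2[OF continuous_q continuous_ldiv]) auto
  then show ?thesis by (simp add: case_prod_beta')
qed

lemma translated_support:
  "\<exists>N K. open N \<and> g \<in> N \<and> compact K \<and>
     (\<forall>g'\<in>N. \<forall>h. tgt G h = tgt G g' \<longrightarrow> h \<notin> K \<longrightarrow> q (ldiv G g' h) = 0 \<and> q h = 0)"
proof -
  obtain L where L: "compact L" "\<And>x. x \<notin> L \<Longrightarrow> q x = 0"
    using qc unfolding compactly_supported_continuous_iff by blast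
  obtain N M where N: "open N" "compact M" "{g} \<subseteq> N" "N \<subseteq> M"
    by (rule compact_neighbourhood[OF locally_compact compact_sing[of g]], rule that)
  let ?K = "L \<union> {mul G k l | k l. k \<in> M \<and> l \<in> L \<and> src G k = tgt G l}"
  have "compact ?K" by (intro compact_Un L compact_product_set N)
  moreover have "q (ldiv G g' h) = 0 \<and> q h = 0" if "g' \<in> N" "tgt G h = tgt G g'" "h \<notin> ?K" for g' h
  proof
    show "q h = 0" using that L(2) by blast
    show "q (ldiv G g' h) = 0"
    proof (rule ccontr)
      assume "q (ldiv G g' h) \<noteq> 0"
      then have "ldiv G g' h \<in> L" using L(2) by blast
      moreover have "g' \<in> M" "src G g' = tgt G (ldiv G g' h)" "h = mul G g' (ldiv G g' h)"
        using that(1) N(4) tgt_ldiv[OF that(2)] mul_ldiv[OF that(2)] by auto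
      ultimately have "h \<in> ?K" by blast
      with that(3) show False by (rule notE)
    qed
  qed
  ultimately show ?thesis using N(1,3)
    by (intro exI[of _ N] exI[of _ ?K] conjI ballI allI impI) simp_all
qed

lemma integrable_translated: "integrable (lam (tgt G g)) (translated q g)"
  unfolding translated_def
proof (rule continuous_fiber_integral(2)[OF continuous_q_ldiv])
  show "\<exists>N K. open N \<and> g \<in> N \<and> compact K \<and> (\<forall>g'\<in>N. \<forall>h. tgt G h = tgt G g' \<longrightarrow> h \<notin> K \<longrightarrow> q (ldiv G g' h) = 0)" for g
  proof -
    obtain N K where N: "open N" "g \<in> N" "compact K"
      and z: "\<forall>g'\<in>N. \<forall>h. tgt G h = tgt G g' \<longrightarrow> h \<notin> K \<longrightarrow> q (ldiv G g' h) = 0 \<and> q h = 0"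
      using translated_support[of g] by - (elim exE conjE, rule that)
    show ?thesis
    proof (rule exI[of _ N], rule exI[of _ K], intro conjI N ballI allI impI)
      fix g' h assume "g' \<in> N" "tgt G h = tgt G g'" "h \<notin> K"
      with z have "q (ldiv G g' h) = 0 \<and> q h = 0" by blast
      then show "q (ldiv G g' h) = 0" by (rule conjunct1)
    qed
  qed
qed

lemma translated_measurable: "translated q g \<in> borel_measurable borel"
  unfolding translated_def by (rule fibered_measurable_slice(1)[OF continuous_q_ldiv])

lemma continuous_displacement: "continuous_on UNIV (displacement q)"
proof -
  have "continuous_on (fibered_pairs G) (\<lambda>p. \<bar>(\<lambda>(g, h). q (ldiv G g h)) p - q (snd p)\<bar>)"
    by (intro continuous_intros continuous_q_ldiv continuous_on_compose2[OF continuous_q]) auto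
  then have c: "continuous_on (fibered_pairs G) (\<lambda>(g, h). \<bar>q (ldiv G g h) - q h\<bar>)"
    by (simp add: case_prod_beta')
  have supp: "\<exists>N K. open N \<and> g \<in> N \<and> compact K \<and>
      (\<forall>g'\<in>N. \<forall>h. tgt G h = tgt G g' \<longrightarrow> h \<notin> K \<longrightarrow> \<bar>q (ldiv G g' h) - q h\<bar> = 0)" for g
  proof -
    obtain N K where N: "open N" "g \<in> N" "compact K"
      and z: "\<forall>g'\<in>N. \<forall>h. tgt G h = tgt G g' \<longrightarrow> h \<notin> K \<longrightarrow> q (ldiv G g' h) = 0 \<and> q h = 0"
      using translated_support[of g] by - (elim exE conjE, rule that)
    show ?thesis
    proof (rule exI[of _ N], rule exI[of _ K], intro conjI N ballI allI impI)
      fix g' h assume "g' \<in> N" "tgt G h = tgt G g'" "h \<notin> K"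
      with z have "q (ldiv G g' h) = 0 \<and> q h = 0" by blast
      then show "\<bar>q (ldiv G g' h) - q h\<bar> = 0" by simp
    qed
  qed
  have "displacement q g = (\<integral>h. (if tgt G g = tgt G h then \<bar>q (ldiv G g h) - q h\<bar> else 0) \<partial>lam (tgt G g))" for g
    unfolding displacement_def
  proof (rule integral_cong_AE)
    show "AE h in lam (tgt G g). \<bar>translated q g h - q h\<bar> = (if tgt G g = tgt G h then \<bar>q (ldiv G g h) - q h\<bar> else 0)"
      using AE_lam[OF tgt_unit[of g]] by eventually_elim (simp add: translated_def)
    show "(\<lambda>h. \<bar>translated q g h - q h\<bar>) \<in> borel_measurable (lam (tgt G g))"
      using measurable_lam[OF tgt_unit[of g] translated_measurable[of g]] integrable_csc[OF tgt_unit[of g] qc] by measurable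
    show "(\<lambda>h. if tgt G g = tgt G h then \<bar>q (ldiv G g h) - q h\<bar> else 0) \<in> borel_measurable (lam (tgt G g))"
      by (intro measurable_lam tgt_unit fibered_measurable_slice c)
  qed
  then show ?thesis using continuous_fiber_integral(1)[OF c supp] by simp
qed

lemma nn_integral_translated:
  assumes q0: "\<And>h. 0 \<le> q h" and f: "f \<in> borel_measurable borel"
  shows "(\<integral>\<^sup>+h. ennreal (translated q g h) * f h \<partial>lam (tgt G g)) = (\<integral>\<^sup>+h. ennreal (q h) * left_translate g f h \<partial>lam (src G g))"
proof -
  have "(\<integral>\<^sup>+h. ennreal (translated q g h) * f h \<partial>lam (tgt G g))
      = (\<integral>\<^sup>+h. ennreal (translated q g h) * f h \<partial>translate G g (lam (src G g)))"
    unfolding lam_translate[symmetric] ..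
  also have "\<dots> = (\<integral>\<^sup>+h. ennreal (translated q g (mul G g h)) * f (mul G g h) * indicator (fiber G (src G g)) h \<partial>lam (src G g))"
    by (rule nn_integral_translate[OF sets_lam[OF src_unit]]) (use translated_measurable f in measurable)
  also have "\<dots> = (\<integral>\<^sup>+h. ennreal (q h) * left_translate g f h \<partial>lam (src G g))"
    by (intro nn_integral_cong)
       (auto simp: indicator_def fiber_def translated_def tgt_mul ldiv_mul)
  finally show ?thesis .
qed

end

text \<open>
Up to the missing masses, \<open>q\<close> and its translate by \<open>g\<close> are the densities of
\<open>theta n (tgt G g)\<close> and \<open>theta n g\<close>. The displacement bounds the differences of integrals of
functions with values in \<open>[0, 1]\<close>, and conversely it is twice the difference for the set where
the translate exceeds \<open>q\<close>, minus the difference of the total masses.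
\<close>

lemma deviation_estimates:
  assumes qc: "compactly_supported_continuous q" and q0: "\<And>h. 0 \<le> q h"
    and qle: "\<And>x f. x \<in> units G \<Longrightarrow> f \<in> borel_measurable borel \<Longrightarrow>
      (\<integral>\<^sup>+h. ennreal (q h) * f h \<partial>lam x) \<le> (\<integral>\<^sup>+h. f h \<partial>theta n x)"
    and s: "1 - e \<le> (\<integral>h. q h \<partial>lam (src G g))" and t: "1 - e \<le> (\<integral>h. q h \<partial>lam (tgt G g))"
  shows "deviation_le n g (displacement q g + 2 * e)"
    and "deviation_le n g d \<Longrightarrow> displacement q g \<le> 2 * d + 3 * e"
proof -
  let ?L = "lam (tgt G g)" and ?T = "translated q g"
  have T0: "0 \<le> ?T h" for h using q0 by (simp add: translated_def)
  have Tle: "(\<integral>\<^sup>+h. ennreal (?T h) * f h \<partial>?L) \<le> (\<integral>\<^sup>+h. f h \<partial>theta n g)"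
    if f: "f \<in> borel_measurable borel" for f
    unfolding nn_integral_translated[OF qc q0 f] nn_integral_theta_translate[OF f]
    by (rule qle[OF src_unit measurable_left_translation[OF f]])
  have iq: "integrable ?L q" and iT: "integrable ?L ?T"
    using integrable_csc[OF tgt_unit qc] integrable_translated[OF qc] by auto
  have mass: "(\<integral>h. ?T h \<partial>?L) = (\<integral>h. q h \<partial>lam (src G g))"
  proof -
    have "(\<integral>\<^sup>+h. ennreal (?T h) \<partial>?L) = (\<integral>\<^sup>+h. ennreal (q h) * left_translate g (\<lambda>_. 1) h \<partial>lam (src G g))"
      using nn_integral_translated[OF qc q0, of "\<lambda>_. 1" g] by simp
    also have "\<dots> = (\<integral>\<^sup>+h. ennreal (q h) \<partial>lam (src G g))"
      by (rule nn_integral_cong_AE)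
         (use AE_lam[OF src_unit[of g]] in \<open>eventually_elim, simp add: fiber_def\<close>)
    finally have "ennreal (\<integral>h. ?T h \<partial>?L) = ennreal (\<integral>h. q h \<partial>lam (src G g))"
      using nn_integral_eq_integral[OF iT] T0 integral_nn_csc[OF src_unit qc q0] by simp
    then show ?thesis using T0 q0 by (subst (asm) ennreal_inj) auto
  qed
  have ST: "(\<integral>h. ?T h * f h \<partial>?L) \<le> P (cesaro n f) g" 
      "P (cesaro n f) g \<le> (\<integral>h. ?T h * f h \<partial>?L) + e" "integrable ?L (\<lambda>h. ?T h * f h)"
    if f: "f \<in> unit_valued" for f
    using subdensity_sandwich[OF prob_theta sets_theta sets_lam[OF tgt_unit] iT T0 Tle f] s
    unfolding integral_theta[OF f] mass by auto
  have SQ: "(\<integral>h. q h * f h \<partial>?L) \<le> P (cesaro n f) (tgt G g)" 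
      "P (cesaro n f) (tgt G g) \<le> (\<integral>h. q h * f h \<partial>?L) + e" "integrable ?L (\<lambda>h. q h * f h)"
    if f: "f \<in> unit_valued" for f
    using subdensity_sandwich[OF prob_theta sets_theta sets_lam[OF tgt_unit] iq q0 qle[OF tgt_unit] f] t
    unfolding integral_theta[OF f] by auto
  show "deviation_le n g (displacement q g + 2 * e)"
    unfolding deviation_le_def
  proof
    fix f :: "'a \<Rightarrow> real" assume f: "f \<in> unit_valued"
    have "(\<integral>h. ?T h * f h \<partial>?L) - (\<integral>h. q h * f h \<partial>?L) = (\<integral>h. (?T h - q h) * f h \<partial>?L)"
      using ST(3)[OF f] SQ(3)[OF f] by (simp add: left_diff_distrib)
    also have "\<bar>\<dots>\<bar> \<le> (\<integral>h. \<bar>(?T h - q h) * f h\<bar> \<partial>?L)" by (rule integral_abs_bound)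
    also have "\<dots> \<le> displacement q g" unfolding displacement_def
    proof (rule integral_mono)
      show "integrable ?L (\<lambda>h. \<bar>(?T h - q h) * f h\<bar>)"
        using ST(3)[OF f] SQ(3)[OF f] by (simp add: left_diff_distrib)
      show "\<bar>(?T h - q h) * f h\<bar> \<le> \<bar>?T h - q h\<bar>" for h
        using unit_valuedD(2,3)[OF f, of h] by (simp add: abs_mult mult_left_le)
    qed (use iq iT in simp)
    finally have "\<bar>(\<integral>h. ?T h * f h \<partial>?L) - (\<integral>h. q h * f h \<partial>?L)\<bar> \<le> displacement q g" .
    then show "\<bar>P (cesaro n f) g - P (cesaro n f) (tgt G g)\<bar> \<le> displacement q g + 2 * e"
      using ST(1,2)[OF f] SQ(1,2)[OF f] by linarith
  qed
  assume d: "deviation_le n g d"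
  define f where "f = indicat_real {h. q h \<le> ?T h}"
  have "{h. q h \<le> ?T h} \<in> sets borel"
    using translated_measurable[OF qc, of g] borel_measurable_continuous_onI[OF continuous_q[OF qc]]
    by measurable
  then have f: "f \<in> unit_valued"
    by (intro unit_valuedI) (auto simp: f_def indicator_def)
  have "displacement q g = (\<integral>h. 2 * (?T h * f h - q h * f h) - (?T h - q h) \<partial>?L)"
    unfolding displacement_def
    by (rule Bochner_Integration.integral_cong) (auto simp: f_def indicator_def)
  also have "\<dots> = 2 * ((\<integral>h. ?T h * f h \<partial>?L) - (\<integral>h. q h * f h \<partial>?L)) - ((\<integral>h. ?T h \<partial>?L) - (\<integral>h. q h \<partial>?L))"
    using ST(3)[OF f] SQ(3)[OF f] iq iT by simp
  also have "\<dots> \<le> 2 * (d + e) - ((1 - e) - 1)"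
  proof -
    have "P (cesaro n f) g - P (cesaro n f) (tgt G g) \<le> d"
      using d f unfolding deviation_le_def by (auto simp: abs_le_iff)
    then have a: "(\<integral>h. ?T h * f h \<partial>?L) - (\<integral>h. q h * f h \<partial>?L) \<le> d + e"
      using ST(1)[OF f] SQ(2)[OF f] by linarith
    have one: "(\<lambda>_. 1) \<in> (unit_valued :: ('a \<Rightarrow> real) set)" by (rule unit_valuedI) auto
    have "(\<integral>h. q h \<partial>?L) \<le> 1"
      using SQ(1)[OF one] unit_valuedD(3)[OF P_unit_valued[OF cesaro_unit_valued[OF one]], of n "tgt G g"]
      by simp
    then have "(1 - e) - 1 \<le> (\<integral>h. ?T h \<partial>?L) - (\<integral>h. q h \<partial>?L)" using s mass by linarith
    with a show ?thesis by argo
  qed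
  finally show "displacement q g \<le> 2 * d + 3 * e" by argo
qed

lemma deviation_le_weaken: "deviation_le n g d \<Longrightarrow> d \<le> d' \<Longrightarrow> deviation_le n g d'"
  unfolding deviation_le_def using order_trans by blast

text \<open>
At \<open>g0\<close> the displacement is at most \<open>5 * d\<close>, so it is less than \<open>6 * d\<close> nearby. The missing masses
at the source and the target add \<open>2 * d\<close>.
\<close>

lemma deviation_le_locally:
  assumes "deviation_le n g0 d" and d: "d > 0"
  shows "\<exists>W. open W \<and> g0 \<in> W \<and> (\<forall>g\<in>W. deviation_le n g (8 * d))"
proof -
  have C: "{src G g0, tgt G g0} \<subseteq> units G" using src_unit tgt_unit by auto
  have compact2: "compact {src G g0, tgt G g0}" by (rule finite_imp_compact) simp
  obtain q where q: "compactly_supported_continuous q" "\<And>h. 0 \<le> q h"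
      "\<And>x f. x \<in> units G \<Longrightarrow> f \<in> borel_measurable borel \<Longrightarrow>
        (\<integral>\<^sup>+h. ennreal (q h) * f h \<partial>lam x) \<le> (\<integral>\<^sup>+h. f h \<partial>theta n x)"
      "\<And>y. y \<in> {src G g0, tgt G g0} \<Longrightarrow> 1 - d < (\<integral>h. q h \<partial>lam y)"
    using exists_theta_subdensity[OF compact2 C d, of n] by blast
  have "displacement q g0 \<le> 2 * d + 3 * d"
    by (rule deviation_estimates(2)[OF q(1,2,3) less_imp_le less_imp_le assms(1)]) (use q(4) in auto)
  then have D: "displacement q g0 < 6 * d" using d by linarith
  let ?W = "{g. displacement q g < 6 * d} \<inter> {g. 1 - d < (\<integral>h. q h \<partial>lam (src G g))} \<inter>
    {g. 1 - d < (\<integral>h. q h \<partial>lam (tgt G g))}"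
  show ?thesis
  proof (intro exI[of _ ?W] conjI ballI)
    show "open ?W"
      by (intro open_Int open_Collect_less continuous_intros continuous_displacement q(1) continuous_integral_tgt)
    show "g0 \<in> ?W" using D q(4) by simp
    fix g assume g: "g \<in> ?W"
    have "deviation_le n g (displacement q g + 2 * d)"
      by (rule deviation_estimates(1)[OF q(1,2,3)]) (use g in auto)
    then show "deviation_le n g (8 * d)"
      by (rule deviation_le_weaken) (use g in simp)
  qed
qed

text \<open>
Dini's argument: the bound holds near each point for one \<open>n\<close>, for all later ones by monotonicity,
and finitely many neighbourhoods cover \<open>K\<close>.
\<close>

lemma deviation_le_uniformly:
  assumes L: "topologically_fiberwise_liouville G lam \<pi>" and K: "compact K" and e: "e > 0"
  shows "\<exists>N. \<forall>n\<ge>N. \<forall>g\<in>K. deviation_le n g e"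
proof -
  have "\<forall>g\<in>K. \<exists>n. \<exists>W. open W \<and> g \<in> W \<and> (\<forall>h\<in>W. deviation_le n h e)"
  proof
    fix g
    obtain n where "deviation_le n g (e / 8)" using exists_deviation_le[OF L, of "e / 8" g] e by auto
    from deviation_le_locally[OF this] e
    have "\<exists>W. open W \<and> g \<in> W \<and> (\<forall>h\<in>W. deviation_le n h e)" by simp
    then show "\<exists>n. \<exists>W. open W \<and> g \<in> W \<and> (\<forall>h\<in>W. deviation_le n h e)" by (rule exI)
  qed
  from bchoice[OF this] obtain n where "\<forall>g\<in>K. \<exists>W. open W \<and> g \<in> W \<and> (\<forall>h\<in>W. deviation_le (n g) h e)"
    by (rule exE)
  from bchoice[OF this] obtain W where W: "\<forall>g\<in>K. open (W g) \<and> g \<in> W g \<and> (\<forall>h\<in>W g. deviation_le (n g) h e)"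
    by (rule exE)
  obtain D where D: "D \<subseteq> K" "finite D" "K \<subseteq> (\<Union>g\<in>D. W g)"
  proof (rule compactE_image[OF K, of K W])
    show "open (W g)" if "g \<in> K" for g using bspec[OF W that] by (rule conjunct1)
    have "g \<in> W g" if "g \<in> K" for g using bspec[OF W that] by (elim conjE)
    then show "K \<subseteq> (\<Union>g\<in>K. W g)" by blast
  qed
  show ?thesis
  proof (intro exI[of _ "\<Sum>g\<in>D. n g"] allI impI ballI)
    fix m g assume m: "(\<Sum>g\<in>D. n g) \<le> m" and g: "g \<in> K"
    obtain g' where g': "g' \<in> D" "g \<in> W g'" using D(3) g by blast
    have "n g' \<le> m" using member_le_sum[OF g'(1), of n] D(2) m by simp
    moreover have "deviation_le (n g') g e" 
    proof -
      have "g' \<in> K" using g'(1) D(1) by (rule rev_subsetD)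
      from bspec[OF W this] have "\<forall>h\<in>W g'. deviation_le (n g') h e" by (elim conjE)
      then show ?thesis using g'(2) by (rule bspec)
    qed
    ultimately show "deviation_le m g e" by (rule deviation_le_mono[rotated])
  qed
qed

lemma liouville_imp_amenable:
  assumes L: "topologically_fiberwise_liouville G lam \<pi>"
  shows "topologically_amenable G"
  unfolding topologically_amenable_def
proof (intro exI[of _ theta] conjI allI ballI impI)
  show "prob_space (theta n x)" for n x by (rule prob_theta)
  show "measure_on_fiber G x (theta n x)" if "x \<in> units G" for n x using that by (rule theta_on_fiber)
  show "continuous_system G (theta n)" for n by (rule continuous_system_theta)
  fix K :: "'a set" assume K: "compact K"
  show "uniform_limit K (\<lambda>n g. total_variation_diff (translate G g (theta n (src G g))) (theta n (tgt G g)))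
     (\<lambda>g. 0) sequentially"
  proof (rule uniform_limitI)
    fix e :: real assume e: "e > 0"
    obtain N where N: "\<And>n g. n \<ge> N \<Longrightarrow> g \<in> K \<Longrightarrow> deviation_le n g (e / 4)"
      using deviation_le_uniformly[OF L K, of "e / 4"] e by auto
    have "dist (total_variation_diff (translate G g (theta n (src G g))) (theta n (tgt G g))) 0 < e"
      if n: "n \<ge> N" and g: "g \<in> K" for n g
    proof -
      have m: "measure (theta n h) A = P (cesaro n (indicator A)) h" if A: "A \<in> sets borel" for A h
      proof -
        have "indicat_real A \<in> unit_valued" using A by (intro unit_valuedI) (auto simp: indicator_def)
        from integral_theta[OF this, of n h] show ?thesis
          using A sets_eq_imp_space_eq[OF sets_theta, of n h] by simp
      qed
      have "\<bar>measure (theta n g) A - measure (theta n (tgt G g)) A\<bar> \<le> e / 4" if "A \<in> sets (theta n g)" for A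
      proof -
        have A: "A \<in> sets borel" using that by simp
        have "indicat_real A \<in> unit_valued" using A by (intro unit_valuedI) (auto simp: indicator_def)
        then show ?thesis using N[OF n g] unfolding deviation_le_def m[OF A] by blast
      qed
      note B = total_variation_diff_bounds[OF finite_theta finite_theta _ this]
      show ?thesis unfolding translate_theta using B e by auto
    qed
    then show "\<forall>\<^sub>F n in sequentially. \<forall>g\<in>K.
        dist (total_variation_diff (translate G g (theta n (src G g))) (theta n (tgt G g))) 0 < e"
      unfolding eventually_sequentially by blast
  qed
qed

end

section \<open>Liouville operators and amenability\<close>

theorem theorem6p1:
  fixes G :: "'a :: {second_countable_topology, t2_space} groupoid_ops"
    and lam \<pi> :: "'a \<Rightarrow> 'a measure"
  assumes "topological_groupoid G"
    and "haar_system G lam"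
    and "invariant_markov_kernel G \<pi>"
    and "continuous_densities G lam \<pi>"
    and "topologically_fiberwise_liouville G lam \<pi>"
  shows "topologically_amenable G"
proof -
  interpret invariant_markov_operator G lam \<pi>
    using assms(1-4)
    by (simp add: invariant_markov_operator_def invariant_markov_operator_axioms_def
        haar_groupoid_def haar_groupoid_axioms_def)
  show ?thesis by (rule liouville_imp_amenable[OF assms(5)])
qed

end
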